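(* Let $(R_0,\mathfrak{m}_0)$ be a Noetherian local ring, $R=\bigoplus_{n\ge0}R_n$ a standard graded $R_0$-algebra possessing a homogeneous system of parameters, and $M=\bigoplus_{n\ge0}M_n$ a finitely generated graded $R$-module. Set $c=\dim R-\dim M$. Assume: (1) $R_0$ and $R$ are Cohen–Macaulay; (2) $M$ is generated as an $R$-module by elements of $M_0$; (3) there exist $y_1,\ldots,y_s\in R_0$ forming a system of parameters of both $M_0$ and $R_0$ and forming part of a homogeneous system of parameters of both $M$ and $R$. Then there exists a homogeneous $R$-regular sequence $\xi_1,\ldots,\xi_c\in R_+$ with $\xi_i\in\operatorname{ann}_RM$ for every $i$.
   Context: Standard graded means $R$ is generated as an $R_0$-algebra by finitely many elements of $R_1$. Systems of parameters for $R$, $M$ are taken with respect to the homogeneous maximal ideal $\mathfrak{m}_0\oplus R_+$; a homogeneous system of parameters consists of homogeneous elements. *)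

theory Defs
  imports Main "HOL-Library.Extended_Nat"
begin

section \<open>Ideals, primes, Noetherian local subrings (carrier S inside a comm_ring_1 type)\<close>

definition ideal_of :: "'a::comm_ring_1 set \<Rightarrow> 'a set \<Rightarrow> bool" where
  "ideal_of S I \<longleftrightarrow> I \<subseteq> S \<and> 0 \<in> I \<and> (\<forall>a\<in>I. \<forall>b\<in>I. a + b \<in> I) \<and> (\<forall>a\<in>I. - a \<in> I)
     \<and> (\<forall>r\<in>S. \<forall>a\<in>I. r * a \<in> I)"

definition prime_of :: "'a::comm_ring_1 set \<Rightarrow> 'a set \<Rightarrow> bool" where
  "prime_of S P \<longleftrightarrow> ideal_of S P \<and> 1 \<notin> P \<and> (\<forall>a\<in>S. \<forall>b\<in>S. a * b \<in> P \<longrightarrow> a \<in> P \<or> b \<in> P)"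

definition maximal_of :: "'a::comm_ring_1 set \<Rightarrow> 'a set \<Rightarrow> bool" where
  "maximal_of S m \<longleftrightarrow> ideal_of S m \<and> 1 \<notin> m \<and>
     (\<forall>J. ideal_of S J \<and> m \<subseteq> J \<longrightarrow> J = m \<or> 1 \<in> J)"

definition gen_ideal :: "'a::comm_ring_1 set \<Rightarrow> 'a set \<Rightarrow> 'a set" where
  "gen_ideal S X = {(\<Sum>x\<in>F. a x * x) | F a. finite F \<and> F \<subseteq> X \<and> (\<forall>x\<in>F. a x \<in> S)}"

definition noetherian_of :: "'a::comm_ring_1 set \<Rightarrow> bool" where
  "noetherian_of S \<longleftrightarrow> (\<forall>I. ideal_of S I \<longrightarrow> (\<exists>F. finite F \<and> F \<subseteq> I \<and> I = gen_ideal S F))"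

definition local_ring_of :: "'a::comm_ring_1 set \<Rightarrow> 'a set \<Rightarrow> bool" where
  "local_ring_of S m \<longleftrightarrow> maximal_of S m \<and> (\<forall>m'. maximal_of S m' \<longrightarrow> m' = m)"

text \<open>Supremum of lengths of chains of primes of S containing I (= dim S/I).\<close>
definition dim_above :: "'a::comm_ring_1 set \<Rightarrow> 'a set \<Rightarrow> enat" where
  "dim_above S I = Sup {enat n | n. \<exists>P :: nat \<Rightarrow> 'a set.
      (\<forall>i\<le>n. prime_of S (P i) \<and> I \<subseteq> P i) \<and> (\<forall>i<n. P i \<subset> P (Suc i))}"

definition height_of :: "'a::comm_ring_1 set \<Rightarrow> 'a set \<Rightarrow> enat" where
  "height_of S p = Sup {enat n | n. \<exists>P :: nat \<Rightarrow> 'a set.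
      (\<forall>i\<le>n. prime_of S (P i)) \<and> (\<forall>i<n. P i \<subset> P (Suc i)) \<and> P n \<subseteq> p}"

section \<open>Modules: a set N \<subseteq> 'b which is an S-module under the action sm\<close>

definition ann_of :: "'a::comm_ring_1 set \<Rightarrow> ('a \<Rightarrow> 'b::ab_group_add \<Rightarrow> 'b) \<Rightarrow> 'b set \<Rightarrow> 'a set" where
  "ann_of S sm N = {r\<in>S. \<forall>x\<in>N. sm r x = 0}"

definition idmod :: "'a::comm_ring_1 set \<Rightarrow> ('a \<Rightarrow> 'b::ab_group_add \<Rightarrow> 'b) \<Rightarrow> 'a set \<Rightarrow> 'b set \<Rightarrow> 'b set" where
  "idmod S sm Y N = {(\<Sum>j<k. sm (a j) (x j)) | (k::nat) a x. \<forall>j<k. a j \<in> gen_ideal S Y \<and> x j \<in> N}"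

definition ann_quot :: "'a::comm_ring_1 set \<Rightarrow> ('a \<Rightarrow> 'b::ab_group_add \<Rightarrow> 'b) \<Rightarrow> 'a set \<Rightarrow> 'b set \<Rightarrow> 'a set" where
  "ann_quot S sm Y N = {r\<in>S. \<forall>x\<in>N. sm r x \<in> idmod S sm Y N}"

definition mdim :: "'a::comm_ring_1 set \<Rightarrow> ('a \<Rightarrow> 'b::ab_group_add \<Rightarrow> 'b) \<Rightarrow> 'b set \<Rightarrow> enat" where
  "mdim S sm N = dim_above S (ann_of S sm N)"

text \<open>System of parameters of N with respect to the ideal m: length = dim N, elements in m,
  and N/(xs)N has finite length, i.e. m is contained in the radical of ann(N/(xs)N).\<close>
definition sop :: "'a::comm_ring_1 set \<Rightarrow> ('a \<Rightarrow> 'b::ab_group_add \<Rightarrow> 'b) \<Rightarrow> 'a set \<Rightarrow> 'b set \<Rightarrow> 'a list \<Rightarrow> bool" where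
  "sop S sm m N xs \<longleftrightarrow> set xs \<subseteq> m \<and> enat (length xs) = mdim S sm N \<and>
     (\<forall>r\<in>m. \<exists>k. r ^ k \<in> ann_quot S sm (set xs) N)"

definition reg_seq :: "'a::comm_ring_1 set \<Rightarrow> ('a \<Rightarrow> 'b::ab_group_add \<Rightarrow> 'b) \<Rightarrow> 'b set \<Rightarrow> 'a list \<Rightarrow> bool" where
  "reg_seq S sm N xs \<longleftrightarrow> set xs \<subseteq> S \<and>
     (\<forall>i<length xs. \<forall>z\<in>N. sm (xs ! i) z \<in> idmod S sm (set (take i xs)) N
        \<longrightarrow> z \<in> idmod S sm (set (take i xs)) N) \<and>
     N \<noteq> idmod S sm (set xs) N"

definition grade_of :: "'a::comm_ring_1 set \<Rightarrow> ('a \<Rightarrow> 'b::ab_group_add \<Rightarrow> 'b) \<Rightarrow> 'a set \<Rightarrow> 'b set \<Rightarrow> enat" where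
  "grade_of S sm I N = Sup {enat (length xs) | xs. set xs \<subseteq> I \<and> reg_seq S sm N xs}"

text \<open>Cohen--Macaulay (Noetherian) ring: grade p = height p for every prime p
  (equivalently depth R_p = dim R_p for all primes p).\<close>
definition CM_ring :: "'a::comm_ring_1 set \<Rightarrow> bool" where
  "CM_ring S \<longleftrightarrow> noetherian_of S \<and>
     (\<forall>p. prime_of S p \<longrightarrow> grade_of S (*) p S = height_of S p)"

definition graded_decomp :: "(nat \<Rightarrow> 'b::ab_group_add set) \<Rightarrow> bool" where
  "graded_decomp G \<longleftrightarrow> (\<forall>n. 0 \<in> G n \<and> (\<forall>a\<in>G n. \<forall>b\<in>G n. a + b \<in> G n) \<and> (\<forall>a\<in>G n. - a \<in> G n)) \<and>
     (\<forall>x. \<exists>!c :: nat \<Rightarrow> 'b. (\<forall>n. c n \<in> G n) \<and> finite {n. c n \<noteq> 0} \<and> x = (\<Sum>n\<in>{n. c n \<noteq> 0}. c n))"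

definition standard_graded :: "(nat \<Rightarrow> 'a::comm_ring_1 set) \<Rightarrow> bool" where
  "standard_graded Rg \<longleftrightarrow> graded_decomp Rg \<and> 1 \<in> Rg 0 \<and>
     (\<forall>i j. \<forall>a\<in>Rg i. \<forall>b\<in>Rg j. a * b \<in> Rg (i + j)) \<and>
     (\<exists>G. finite G \<and> G \<subseteq> Rg 1 \<and>
        (\<forall>T. Rg 0 \<union> G \<subseteq> T \<and> (\<forall>a\<in>T. \<forall>b\<in>T. a + b \<in> T \<and> a * b \<in> T) \<and> (\<forall>a\<in>T. - a \<in> T)
             \<longrightarrow> T = UNIV))"

definition graded_module :: "(nat \<Rightarrow> 'a::comm_ring_1 set) \<Rightarrow> ('a \<Rightarrow> 'b::ab_group_add \<Rightarrow> 'b)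
    \<Rightarrow> (nat \<Rightarrow> 'b set) \<Rightarrow> bool" where
  "graded_module Rg sm Mg \<longleftrightarrow> module sm \<and> graded_decomp Mg \<and>
     (\<forall>i j. \<forall>a\<in>Rg i. \<forall>x\<in>Mg j. sm a x \<in> Mg (i + j))"

definition homogeneous :: "(nat \<Rightarrow> 'a set) \<Rightarrow> 'a \<Rightarrow> bool" where
  "homogeneous Rg x \<longleftrightarrow> (\<exists>n. x \<in> Rg n)"

definition irrelevant :: "(nat \<Rightarrow> 'a::comm_ring_1 set) \<Rightarrow> 'a set" where
  "irrelevant Rg = {x. \<exists>c :: nat \<Rightarrow> 'a. (\<forall>n. c n \<in> Rg n) \<and> finite {n. c n \<noteq> 0} \<and> c 0 = 0
        \<and> x = (\<Sum>n\<in>{n. c n \<noteq> 0}. c n)}"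

definition hom_max :: "(nat \<Rightarrow> 'a::comm_ring_1 set) \<Rightarrow> 'a set \<Rightarrow> 'a set" where
  "hom_max Rg m0 = {a + b | a b. a \<in> m0 \<and> b \<in> irrelevant Rg}"

end

theory Submission
  imports Defs
begin

text \<open>Let \<open>d = dim R\<close>, \<open>e = dim M\<close> and \<open>I = ann M\<close>. Extend a homogeneous regular sequence
  \<open>\<xi>\<^sub>1, \<dots>, \<xi>\<^sub>g\<close> in \<open>I \<inter> R\<^sub>+\<close> as long as possible. When it cannot be extended, homogeneous prime
  avoidance puts \<open>I \<inter> R\<^sub>+\<close> into an associated prime \<open>P\<close> of \<open>R/(\<xi>)\<close>, so \<open>I \<subseteq> P\<close> or \<open>R\<^sub>+ \<subseteq> P\<close>.
  In the first case \<open>dim R/P \<le> e\<close>, in the second \<open>dim R/P \<le> dim R\<^sub>0 = length ys \<le> e\<close>, since \<open>ys\<close> is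
  part of a system of parameters of \<open>M\<close>. On the other hand the depth of \<open>R/(\<xi>)\<close> at the homogeneous
  maximal ideal is a lower bound for \<open>dim R/P\<close>, and it equals \<open>d - g\<close> by Rees' theorem and the
  Cohen--Macaulay property, because \<open>d\<close> is the height of the homogeneous maximal ideal. Hence
  \<open>g \<ge> d - e\<close>.\<close>

section \<open>Ideals of a Noetherian ring\<close>

text \<open>\<open>CM_ring\<close> compares grade and height at a single prime, whereas
  \<open>d\<close> is a supremum over all chains of primes of R, and R may have many maximal ideals
  besides \<open>\<mm>\<close>. Chains are therefore pushed into \<open>\<mm>\<close>: replacing the
  last prime by the largest homogeneous ideal inside it costs one step, and appending
  \<open>\<mm>\<close> regains it. The Cohen-Macaulay property then yields some regular sequence of
  length \<open>d\<close> in \<open>\<mm>\<close>, with no relation to the one being built inside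
  \<open>I\<close>. Rees' theorem bridges the two; it is proved without Ext, by exchanging entries
  of regular sequences and transporting socle elements along. Neither quotients nor localisations
  are formed. The ring R/K is represented by the ideal K, and localisation by the saturation
  \<open>sat\<close>, which fixes every homogeneous ideal when the complement of
  \<open>\<mm>\<close> is inverted.\<close>

abbreviation ideal :: "'a::comm_ring_1 set \<Rightarrow> bool" where
  "ideal \<equiv> ideal_of UNIV"

abbreviation prime_ideal :: "'a::comm_ring_1 set \<Rightarrow> bool" where
  "prime_ideal \<equiv> prime_of UNIV"

lemma ideal_zero: "ideal I \<Longrightarrow> 0 \<in> I"
  and ideal_add: "ideal I \<Longrightarrow> a \<in> I \<Longrightarrow> b \<in> I \<Longrightarrow> a + b \<in> I"
  and ideal_uminus: "ideal I \<Longrightarrow> a \<in> I \<Longrightarrow> - a \<in> I"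
  and ideal_mult_left: "ideal I \<Longrightarrow> a \<in> I \<Longrightarrow> r * a \<in> I"
  by (auto simp: ideal_of_def)

lemma ideal_mult_right: "ideal I \<Longrightarrow> a \<in> I \<Longrightarrow> a * r \<in> I"
  using ideal_mult_left[of I a r] by (simp add: mult.commute)

lemma ideal_diff: "ideal I \<Longrightarrow> a \<in> I \<Longrightarrow> b \<in> I \<Longrightarrow> a - b \<in> I"
  using ideal_add[of I a "- b"] ideal_uminus[of I b] by simp

lemma ideal_sum: "ideal I \<Longrightarrow> (\<And>x. x \<in> F \<Longrightarrow> f x \<in> I) \<Longrightarrow> sum f F \<in> I"
  by (induction F rule: infinite_finite_induct) (auto intro: ideal_zero ideal_add)

lemma ideal_add_cancel: "ideal I \<Longrightarrow> a + b \<in> I \<Longrightarrow> a \<in> I \<Longrightarrow> b \<in> I"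
  using ideal_diff[of I "a + b" a] by simp

lemma ideal_singleton_zero: "ideal {0}"
  by (simp add: ideal_of_def)

lemma prime_ideal_ideal: "prime_ideal P \<Longrightarrow> ideal P"
  and prime_ideal_one: "prime_ideal P \<Longrightarrow> 1 \<notin> P"
  and prime_ideal_mult: "prime_ideal P \<Longrightarrow> a * b \<in> P \<Longrightarrow> a \<in> P \<or> b \<in> P"
  by (auto simp: prime_of_def)

lemma prime_ideal_power: "prime_ideal P \<Longrightarrow> a ^ n \<in> P \<Longrightarrow> a \<in> P"
  by (induction n) (auto dest: prime_ideal_one prime_ideal_mult)

lemma gen_ideal_ideal: "ideal (gen_ideal UNIV X)"
  unfolding ideal_of_def
proof (intro conjI ballI)
  show "0 \<in> gen_ideal UNIV X"
    unfolding gen_ideal_def by (auto intro!: exI[of _ "{}"])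
next
  fix p q assume "p \<in> gen_ideal UNIV X" "q \<in> gen_ideal UNIV X"
  then obtain F a F' b where F: "finite F" "F \<subseteq> X" "p = (\<Sum>x\<in>F. a x * x)"
    and F': "finite F'" "F' \<subseteq> X" "q = (\<Sum>x\<in>F'. b x * x)"
    unfolding gen_ideal_def by auto
  have "p = (\<Sum>x\<in>F \<union> F'. (if x \<in> F then a x else 0) * x)"
    unfolding F(3) using F F' by (intro sum.mono_neutral_cong_left) auto
  moreover have "q = (\<Sum>x\<in>F \<union> F'. (if x \<in> F' then b x else 0) * x)"
    unfolding F'(3) using F F' by (intro sum.mono_neutral_cong_left) auto
  ultimately have "p + q = (\<Sum>x\<in>F \<union> F'. ((if x \<in> F then a x else 0) + (if x \<in> F' then b x else 0)) * x)"
    by (simp add: sum.distrib distrib_right)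
  moreover have "finite (F \<union> F')" "F \<union> F' \<subseteq> X" using F F' by auto
  ultimately show "p + q \<in> gen_ideal UNIV X"
    unfolding gen_ideal_def mem_Collect_eq
    by (intro exI[of _ "F \<union> F'"] exI[of _ "\<lambda>x. (if x \<in> F then a x else 0) + (if x \<in> F' then b x else 0)"]) simp
next
  fix r p assume "p \<in> gen_ideal UNIV X"
  then obtain F a where F: "finite F" "F \<subseteq> X" "p = (\<Sum>x\<in>F. a x * x)"
    unfolding gen_ideal_def by auto
  have "r * p = (\<Sum>x\<in>F. (r * a x) * x)"
    unfolding F by (simp add: sum_distrib_left mult.assoc)
  then show "r * p \<in> gen_ideal UNIV X"
    unfolding gen_ideal_def mem_Collect_eq using F by (intro exI[of _ F] exI[of _ "\<lambda>x. r * a x"]) simp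
next
  fix p assume "p \<in> gen_ideal UNIV X"
  then obtain F a where F: "finite F" "F \<subseteq> X" "p = (\<Sum>x\<in>F. a x * x)"
    unfolding gen_ideal_def by auto
  have "- p = (\<Sum>x\<in>F. (- a x) * x)"
    unfolding F by (simp add: sum_negf)
  then show "- p \<in> gen_ideal UNIV X"
    unfolding gen_ideal_def mem_Collect_eq using F by (intro exI[of _ F] exI[of _ "\<lambda>x. - a x"]) simp
qed simp

lemma gen_ideal_superset: "X \<subseteq> gen_ideal UNIV X"
proof
  fix x assume "x \<in> X"
  then show "x \<in> gen_ideal UNIV X"
    unfolding gen_ideal_def by (auto intro!: exI[of _ "{x}"] exI[of _ "\<lambda>_. 1"])
qed

lemma gen_ideal_least: "ideal I \<Longrightarrow> X \<subseteq> I \<Longrightarrow> gen_ideal UNIV X \<subseteq> I"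
  unfolding gen_ideal_def by (auto intro!: ideal_sum intro: ideal_mult_left)

lemma idmod_eq_gen_ideal: "idmod UNIV (*) X (UNIV :: 'a::comm_ring_1 set) = gen_ideal UNIV X"
proof
  show "idmod UNIV (*) X (UNIV :: 'a set) \<subseteq> gen_ideal UNIV X"
    unfolding idmod_def by (auto intro!: ideal_sum gen_ideal_ideal ideal_mult_right)
  show "gen_ideal UNIV X \<subseteq> idmod UNIV (*) X (UNIV :: 'a set)"
  proof
    fix y assume "y \<in> gen_ideal UNIV X"
    then show "y \<in> idmod UNIV (*) X UNIV"
      unfolding idmod_def mem_Collect_eq
      by (intro exI[of _ "Suc 0"] exI[of _ "\<lambda>_. y"] exI[of _ "\<lambda>_. 1::'a"]) simp
  qed
qed

lemma Union_chain_ideal: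
  assumes "\<And>I. I \<in> C \<Longrightarrow> ideal_of S I" and "C \<noteq> {}" and "subset.chain A C"
  shows "ideal_of S (\<Union>C)"
proof -
  have sub: "I \<subseteq> J \<or> J \<subseteq> I" if "I \<in> C" "J \<in> C" for I J
    using assms(3) that by (auto simp: subset_chain_def)
  show ?thesis
    unfolding ideal_of_def
  proof (intro conjI ballI)
    show "\<Union>C \<subseteq> S" using assms(1) unfolding ideal_of_def by blast
    show "0 \<in> \<Union>C" using assms(1,2) by (auto simp: ideal_of_def)
    show "- a \<in> \<Union>C" if "a \<in> \<Union>C" for a
      using that assms(1) unfolding ideal_of_def by blast
    show "r * a \<in> \<Union>C" if "r \<in> S" "a \<in> \<Union>C" for r a
      using that assms(1) unfolding ideal_of_def by blast
    fix a b assume "a \<in> \<Union>C" "b \<in> \<Union>C"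
    then obtain I where "I \<in> C" "a \<in> I" "b \<in> I" using sub by blast
    then show "a + b \<in> \<Union>C" using assms(1) unfolding ideal_of_def by blast
  qed
qed

text \<open>The finitely many generators of the union of a chain already lie in one member of the
  chain, so Zorn's lemma applies.\<close>

lemma noetherian_maximal:
  assumes noeth: "noetherian_of (UNIV :: 'a::comm_ring_1 set)"
    and "\<A> \<noteq> {}" and ideals: "\<And>I::'a set. I \<in> \<A> \<Longrightarrow> ideal I"
  obtains I where "I \<in> \<A>" "\<And>J. J \<in> \<A> \<Longrightarrow> I \<subseteq> J \<Longrightarrow> J = I"
proof -
  have "\<Union>C \<in> \<A>" if C: "C \<noteq> {}" "subset.chain \<A> C" for C
  proof -
    have "ideal (\<Union>C)"
      using C ideals by (intro Union_chain_ideal[OF _ C]) (auto simp: subset_chain_def)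
    then have "\<exists>F. finite F \<and> F \<subseteq> \<Union>C \<and> \<Union>C = gen_ideal UNIV F"
      using noeth unfolding noetherian_of_def by (elim allE impE)
    then obtain F where F: "finite F" "F \<subseteq> \<Union>C" "\<Union>C = gen_ideal UNIV F"
      by (elim exE conjE)
    then obtain I where I: "I \<in> C" "F \<subseteq> I"
      using finite_subset_Union_chain[OF F(1,2) C] by blast
    then have "I \<in> \<A>" using C by (auto simp: subset_chain_def)
    then have "\<Union>C \<subseteq> I"
      unfolding F(3) by (intro gen_ideal_least ideals I(2))
    then have "\<Union>C = I" using I by blast
    then show ?thesis using \<open>I \<in> \<A>\<close> by simp
  qed
  then show thesis
    using subset_Zorn_nonempty[OF \<open>\<A> \<noteq> {}\<close>] that by blast
qed

lemma proper_ideal_subset_local: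
  assumes "local_ring_of S m" and "ideal_of S J" and "1 \<notin> J"
  shows "J \<subseteq> m"
proof -
  let ?\<A> = "{I. ideal_of S I \<and> 1 \<notin> I \<and> J \<subseteq> I}"
  have "\<Union>C \<in> ?\<A>" if C: "C \<noteq> {}" "subset.chain ?\<A> C" for C
  proof -
    have "ideal_of S (\<Union>C)"
      using C by (intro Union_chain_ideal[OF _ C]) (auto simp: subset_chain_def)
    then show ?thesis using C by (auto simp: subset_chain_def)
  qed
  moreover have "?\<A> \<noteq> {}" using assms by blast
  ultimately have "\<exists>I\<in>?\<A>. \<forall>X\<in>?\<A>. I \<subseteq> X \<longrightarrow> X = I"
    by (intro subset_Zorn_nonempty)
  then obtain I where I: "I \<in> ?\<A>" "\<forall>X\<in>?\<A>. I \<subseteq> X \<longrightarrow> X = I"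
    by (elim bexE)
  have "L = I \<or> 1 \<in> L" if "ideal_of S L" "I \<subseteq> L" for L
    using I that by blast
  then have "maximal_of S I"
    unfolding maximal_of_def using I(1) by simp
  then show ?thesis using assms(1) I(1) by (auto simp: local_ring_of_def)
qed

section \<open>Zero divisors modulo an ideal and prime avoidance\<close>

definition colon :: "'a::comm_ring_1 set \<Rightarrow> 'a \<Rightarrow> 'a set" where
  "colon K u = {r. r * u \<in> K}"

text \<open>Multiplication by x is injective on R/K. This includes the zero ring K =
  \<open>UNIV\<close>, so properness has to be recorded separately.\<close>

definition nzd :: "'a::comm_ring_1 set \<Rightarrow> 'a \<Rightarrow> bool" where
  "nzd K x \<longleftrightarrow> (\<forall>z. x * z \<in> K \<longrightarrow> z \<in> K)"

lemma nzdD: "nzd K x \<Longrightarrow> x * z \<in> K \<Longrightarrow> z \<in> K"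
  by (simp add: nzd_def)

text \<open>For an ideal K of a Noetherian ring these are the maximal elements of Ass(R/K),
  described as maximal annihilators of nonzero elements. Every zero divisor on R/K lies in one of
  them, which is what prime avoidance needs.\<close>

definition maximal_colons :: "'a::comm_ring_1 set \<Rightarrow> 'a set set" where
  "maximal_colons K = {P. \<exists>u. u \<notin> K \<and> P = colon K u \<and> (\<forall>v. v \<notin> K \<longrightarrow> P \<subseteq> colon K v \<longrightarrow> colon K v = P)}"

lemma colon_ideal: "ideal K \<Longrightarrow> ideal (colon K u)"
  by (auto simp: ideal_of_def colon_def distrib_right mult.assoc)

text \<open>For b outside P the element \<open>b * u\<close> is again nonzero modulo K, and by
  maximality it has the same annihilator as u.\<close>

lemma maximal_colons_prime:
  assumes "ideal K" and "P \<in> maximal_colons K"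
  shows "prime_ideal P"
proof -
  obtain u where u: "u \<notin> K" "P = colon K u"
    and max: "\<And>v. v \<notin> K \<Longrightarrow> P \<subseteq> colon K v \<Longrightarrow> colon K v = P"
    using assms(2) unfolding maximal_colons_def by blast
  have "a \<in> P" if "a * b \<in> P" "b \<notin> P" for a b
  proof -
    have "b * u \<notin> K" using that u by (simp add: colon_def)
    moreover have "P \<subseteq> colon K (b * u)"
      using u ideal_mult_left[OF assms(1), of _ b] by (auto simp: colon_def mult.left_commute[of _ b])
    ultimately have "colon K (b * u) = P" by (rule max)
    then show ?thesis using that(1) u by (auto simp: colon_def mult.assoc)
  qed
  then show ?thesis
    using u colon_ideal[OF assms(1), of u] by (auto simp: prime_of_def colon_def)
qed

lemma colon_subset_maximal:
  assumes noeth: "noetherian_of (UNIV :: 'a::comm_ring_1 set)"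
    and K: "ideal (K :: 'a set)" and u: "u \<notin> K"
  obtains v where "v \<notin> K" "colon K u \<subseteq> colon K v" "colon K v \<in> maximal_colons K"
proof -
  let ?\<A> = "{colon K v | v. v \<notin> K \<and> colon K u \<subseteq> colon K v}"
  obtain I where "I \<in> ?\<A>" and I: "\<And>J. J \<in> ?\<A> \<Longrightarrow> I \<subseteq> J \<Longrightarrow> J = I"
  proof (rule noetherian_maximal[OF noeth, of ?\<A>])
    show "?\<A> \<noteq> {}" using u by blast
    show "ideal I" if "I \<in> ?\<A>" for I using that colon_ideal[OF K] by auto
  qed blast
  then obtain v where v: "v \<notin> K" "I = colon K v" "colon K u \<subseteq> colon K v" by auto
  have "colon K w = colon K v" if "w \<notin> K" "colon K v \<subseteq> colon K w" for w
    using I[of "colon K w"] v that by auto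
  then have "colon K v \<in> maximal_colons K"
    unfolding maximal_colons_def using v(1) by auto
  then show thesis by (intro that[of v] v)
qed

lemma prime_ideal_finite_Inter:
  assumes "finite F" and "prime_ideal P" and "\<And>f. f \<in> F \<Longrightarrow> ideal (Q f)"
    and "\<Inter> (Q ` F) \<subseteq> P"
  shows "\<exists>f\<in>F. Q f \<subseteq> P"
  using assms
proof (induction F)
  case empty
  then show ?case using prime_ideal_one by auto
next
  case (insert f F)
  show ?case
  proof (cases "Q f \<subseteq> P")
    case False
    then obtain a where a: "a \<in> Q f" "a \<notin> P" by blast
    have "b \<in> P" if b: "b \<in> \<Inter> (Q ` F)" for b
    proof -
      have "a * b \<in> \<Inter> (Q ` insert f F)"
        using a b insert.prems(2) by (auto intro: ideal_mult_left ideal_mult_right)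
      then show ?thesis
        using insert.prems(1,3) a prime_ideal_mult by blast
    qed
    then have "\<Inter> (Q ` F) \<subseteq> P" by blast
    then show ?thesis using insert.IH insert.prems by blast
  qed blast
qed

text \<open>Finitely many of the elements u that define maximal colons generate all the others. If f
  runs through these generators, the intersection of the ideals \<open>colon K f\<close> lies in
  every maximal colon P; being prime, P contains one of them, and maximality makes the two
  equal.\<close>

lemma finite_maximal_colons:
  assumes noeth: "noetherian_of (UNIV :: 'a::comm_ring_1 set)" and K: "ideal (K :: 'a set)"
  shows "finite (maximal_colons K)"
proof -
  define U where "U = {u. u \<notin> K \<and> colon K u \<in> maximal_colons K}"
  let ?\<A> = "{gen_ideal UNIV F | F. finite F \<and> F \<subseteq> U}"
  obtain I where "I \<in> ?\<A>" and I: "\<And>J. J \<in> ?\<A> \<Longrightarrow> I \<subseteq> J \<Longrightarrow> J = I"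
  proof (rule noetherian_maximal[OF noeth, of ?\<A>])
    show "?\<A> \<noteq> {}" by blast
  qed (auto intro: gen_ideal_ideal)
  then obtain F where F: "finite F" "F \<subseteq> U" "I = gen_ideal UNIV F" by auto
  have U_sub: "u \<in> gen_ideal UNIV F" if u: "u \<in> U" for u
  proof -
    have "F \<subseteq> gen_ideal UNIV (insert u F)" using gen_ideal_superset[of "insert u F"] by auto
    then have "I \<subseteq> gen_ideal UNIV (insert u F)"
      unfolding F(3) by (intro gen_ideal_least gen_ideal_ideal)
    then have "gen_ideal UNIV (insert u F) = I" using F u by (intro I) auto
    then show ?thesis using gen_ideal_superset[of "insert u F"] F(3) by auto
  qed
  have "maximal_colons K \<subseteq> colon K ` F"
  proof
    fix P assume P: "P \<in> maximal_colons K"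
    then obtain u where u: "u \<notin> K" "P = colon K u" unfolding maximal_colons_def by blast
    have "\<Inter> (colon K ` F) \<subseteq> P"
    proof
      fix r assume "r \<in> \<Inter> (colon K ` F)"
      then have "F \<subseteq> colon K r" by (auto simp: colon_def mult.commute)
      then have "gen_ideal UNIV F \<subseteq> colon K r" using gen_ideal_least colon_ideal[OF K] by blast
      then have "u \<in> colon K r" using U_sub P u by (auto simp: U_def)
      then show "r \<in> P" using u by (simp add: colon_def mult.commute)
    qed
    then obtain f where "f \<in> F" "colon K f \<subseteq> P"
      using prime_ideal_finite_Inter[OF F(1) maximal_colons_prime[OF K P]] colon_ideal[OF K] by blast
    moreover have "colon K f \<in> maximal_colons K" using \<open>f \<in> F\<close> F by (auto simp: U_def)
    then have "P = colon K f"
      using \<open>colon K f \<subseteq> P\<close> u unfolding maximal_colons_def by blast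
    ultimately show "P \<in> colon K ` F" by blast
  qed
  then show ?thesis using F(1) finite_surj by blast
qed

lemma nzd_iff_maximal_colons:
  assumes noeth: "noetherian_of (UNIV :: 'a::comm_ring_1 set)" and K: "ideal (K :: 'a set)"
  shows "nzd K x \<longleftrightarrow> x \<notin> \<Union> (maximal_colons K)"
proof
  assume "nzd K x"
  then show "x \<notin> \<Union> (maximal_colons K)"
    by (auto simp: maximal_colons_def nzd_def colon_def)
next
  assume x: "x \<notin> \<Union> (maximal_colons K)"
  show "nzd K x"
    unfolding nzd_def
  proof (intro allI impI, rule ccontr)
    fix z assume "x * z \<in> K" "z \<notin> K"
    then obtain v where "colon K z \<subseteq> colon K v" "colon K v \<in> maximal_colons K"
      using colon_subset_maximal[OF noeth K] by blast
    then show False using x \<open>x * z \<in> K\<close> by (auto simp: colon_def)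
  qed
qed

text \<open>The closure conditions on \<open>H\<close> cover both an ideal and the homogeneous elements of
  positive degree of an ideal: in the latter case powers are needed to equalise degrees.\<close>

lemma prime_avoidance:
  assumes H: "\<And>x y. x \<in> H \<Longrightarrow> y \<in> H \<Longrightarrow> x * y \<in> H"
      "\<And>x y. x \<in> H \<Longrightarrow> y \<in> H \<Longrightarrow> \<exists>i j. i > 0 \<and> j > 0 \<and> x ^ i + y ^ j \<in> H"
    and "H \<noteq> {}"
    and fin: "finite \<P>" and "\<And>P. P \<in> \<P> \<Longrightarrow> prime_ideal P"
    and "\<And>P. P \<in> \<P> \<Longrightarrow> \<not> H \<subseteq> P"
  shows "\<exists>x\<in>H. x \<notin> \<Union>\<P>"
  using fin assms(5,6)
proof (induction \<P> rule: finite_psubset_induct)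
  case (psubset \<P>)
  show ?case
  proof (rule ccontr)
    assume no: "\<not> ?case"
    obtain P0 where P0: "P0 \<in> \<P>" using no \<open>H \<noteq> {}\<close> by auto
    have ne: "\<P> - {P0} \<noteq> {}"
    proof
      assume "\<P> - {P0} = {}"
      then have "\<P> = {P0}" using P0 by blast
      then show False using no psubset.prems(2)[OF P0] by auto
    qed
    \<comment> \<open>For a minimal counterexample every proper subfamily can be avoided, so each P
      contains an element of H that lies in no other member.\<close>
    have "\<exists>x\<in>H. x \<in> P \<and> x \<notin> \<Union>(\<P> - {P})" if "P \<in> \<P>" for P
    proof -
      have "\<exists>x\<in>H. x \<notin> \<Union>(\<P> - {P})" using that psubset.prems by (intro psubset.IH) blast+
      then show ?thesis using no by blast
    qed
    then have "\<forall>P\<in>\<P>. \<exists>x. x \<in> H \<and> x \<in> P \<and> x \<notin> \<Union>(\<P> - {P})" by blast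
    from bchoice[OF this] obtain u
      where u: "\<And>P. P \<in> \<P> \<Longrightarrow> u P \<in> H \<and> u P \<in> P \<and> u P \<notin> \<Union>(\<P> - {P})" by blast
    have prod_H: "prod u F \<in> H" if "finite F" "F \<noteq> {}" "F \<subseteq> \<P>" for F
      using that by (induction F rule: finite_ne_induct) (simp_all add: H(1) u)
    have prod_P0: "prod u F \<notin> P0" if "finite F" "F \<subseteq> \<P> - {P0}" for F
      using that
    proof (induction F)
      case empty
      then show ?case using psubset.prems(1)[OF P0] prime_ideal_one by auto
    next
      case (insert P F)
      then have "u P \<notin> P0" using u[of P] P0 by auto
      then show ?case using insert prime_ideal_mult[OF psubset.prems(1)[OF P0]] by auto
    qed
    \<comment> \<open>\<open>w\<close> lies in every member except \<open>P0\<close>, and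
      \<open>u P0\<close> lies in \<open>P0\<close> only. Hence a sum of powers of the two lies in
      no member at all.\<close>
    define w where "w = prod u (\<P> - {P0})"
    have w: "w \<in> H" "w \<notin> P0"
      using prod_H[of "\<P> - {P0}"] prod_P0[of "\<P> - {P0}"] ne psubset.hyps(1) by (auto simp: w_def)
    have wP: "w \<in> P" if "P \<in> \<P> - {P0}" for P
    proof -
      have "w = u P * prod u (\<P> - {P0} - {P})"
        unfolding w_def using that psubset.hyps(1) by (intro prod.remove) auto
      then show ?thesis
        using that u[of P] ideal_mult_right[OF prime_ideal_ideal[OF psubset.prems(1)[of P]]] by simp
    qed
    obtain i j where ij: "i > 0" "j > 0" "u P0 ^ i + w ^ j \<in> H"
      using H(2)[of "u P0" w] u[OF P0] w(1) by blast
    have pow: "a ^ k \<in> P" if "k > 0" "a \<in> P" "P \<in> \<P>" for a k P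
      using that ideal_mult_right[OF prime_ideal_ideal[OF psubset.prems(1)], of P a "a ^ (k - 1)"]
      by (cases k) simp_all
    obtain P where P: "P \<in> \<P>" "u P0 ^ i + w ^ j \<in> P" using no ij by blast
    note idP = prime_ideal_ideal[OF psubset.prems(1)[OF P(1)]]
    show False
    proof (cases "P = P0")
      case True
      then have "u P0 ^ i \<in> P" using pow[OF ij(1)] u[OF P0] P0 by simp
      then have "w ^ j \<in> P0" using ideal_add_cancel[OF idP P(2)] True by simp
      then show False using w prime_ideal_power psubset.prems(1)[OF P0] by blast
    next
      case False
      then have "w ^ j \<in> P" using pow[OF ij(2) wP P(1)] P(1) by simp
      then have "u P0 ^ i \<in> P" using ideal_add_cancel[OF idP, of "w ^ j"] P(2) by (simp add: add.commute)
      then have "u P0 \<in> P" using prime_ideal_power psubset.prems(1)[OF P(1)] by blast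
      then show False using u[OF P0] False P by blast
    qed
  qed
qed

lemma ideal_prime_avoidance:
  assumes A: "ideal A" and "finite \<P>" and "\<And>P. P \<in> \<P> \<Longrightarrow> prime_ideal P"
    and "\<And>P. P \<in> \<P> \<Longrightarrow> \<not> A \<subseteq> P"
  shows "\<exists>x\<in>A. x \<notin> \<Union>\<P>"
proof (rule prime_avoidance[OF _ _ _ assms(2-4)])
  show "\<exists>i j. 0 < i \<and> 0 < j \<and> x ^ i + y ^ j \<in> A" if "x \<in> A" "y \<in> A" for x y
    using that ideal_add[OF A, of x y] by (intro exI[of _ 1]) simp
  show "A \<noteq> {}" using ideal_zero[OF A] by blast
qed (simp add: ideal_mult_left[OF A])

text \<open>Prime avoidance is applied to the maximal colons of all the ideals K at once. The common
  element is what allows two unrelated regular sequences to be linked.\<close>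

lemma common_nzd:
  assumes noeth: "noetherian_of (UNIV :: 'a::comm_ring_1 set)" and A: "ideal (A :: 'a set)"
    and fin: "finite \<K>" and K: "\<And>K. K \<in> \<K> \<Longrightarrow> ideal K" "\<And>K. K \<in> \<K> \<Longrightarrow> \<exists>a\<in>A. nzd K a"
  shows "\<exists>z\<in>A. \<forall>K\<in>\<K>. nzd K z"
proof -
  let ?\<P> = "\<Union>(maximal_colons ` \<K>)"
  have "\<exists>z\<in>A. z \<notin> \<Union>?\<P>"
  proof (rule ideal_prime_avoidance[OF A])
    show "finite ?\<P>" using fin finite_maximal_colons[OF noeth K(1)] by simp
    fix P assume "P \<in> ?\<P>"
    then obtain L where L: "L \<in> \<K>" "P \<in> maximal_colons L" by blast
    show "prime_ideal P" by (rule maximal_colons_prime[OF K(1)[OF L(1)] L(2)])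
    show "\<not> A \<subseteq> P" using K(2)[OF L(1)] nzd_iff_maximal_colons[OF noeth K(1)[OF L(1)]] L(2) by blast
  qed
  then obtain z where z: "z \<in> A" "z \<notin> \<Union>?\<P>" by blast
  have "nzd L z" if "L \<in> \<K>" for L
    using z(2) that nzd_iff_maximal_colons[OF noeth K(1)[OF that]] by blast
  then show ?thesis using z(1) by blast
qed

section \<open>Regular sequences modulo an ideal\<close>

text \<open>The ideal K + (x). Dividing R/K by x becomes enlarging K, so all the quotients are
  treated inside the one type of R.\<close>

definition adj :: "'a::comm_ring_1 set \<Rightarrow> 'a \<Rightarrow> 'a set" where
  "adj K x = {k + r * x | k r. k \<in> K}"

definition adjs :: "'a::comm_ring_1 set \<Rightarrow> 'a list \<Rightarrow> 'a set" where
  "adjs = foldl adj"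

text \<open>Weakly regular sequences on R/K: the final quotient may vanish. This keeps the
  inductions free of side conditions; properness returns in
  \<open>reg_seq_iff_regular\<close>.\<close>

fun regular :: "'a::comm_ring_1 set \<Rightarrow> 'a list \<Rightarrow> bool" where
  "regular K [] \<longleftrightarrow> True"
| "regular K (x # xs) \<longleftrightarrow> nzd K x \<and> regular (adj K x) xs"

lemma adjs_simps [simp]:
  "adjs K [] = K" "adjs K (x # xs) = adjs (adj K x) xs" "adjs K (xs @ ys) = adjs (adjs K xs) ys"
  by (simp_all add: adjs_def)

lemma adjI: "k \<in> K \<Longrightarrow> k + r * x \<in> adj K x"
  by (auto simp: adj_def)

lemma adjE:
  assumes "y \<in> adj K x"
  obtains k r where "k \<in> K" "y = k + r * x"
  using assms by (auto simp: adj_def)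

lemma adj_superset: "K \<subseteq> adj K x"
  using adjI[of _ K 0 x] by auto

lemma adj_mem: "ideal K \<Longrightarrow> r * x \<in> adj K x"
  using adjI[OF ideal_zero, of K r x] by simp

lemma adj_ideal:
  assumes K: "ideal K"
  shows "ideal (adj K x)"
  unfolding ideal_of_def
proof (intro conjI ballI)
  show "0 \<in> adj K x" using adj_mem[OF K, of 0] by simp
next
  fix a b assume "a \<in> adj K x" "b \<in> adj K x"
  then obtain k r l s where "k \<in> K" "a = k + r * x" "l \<in> K" "b = l + s * x" by (auto elim!: adjE)
  then show "a + b \<in> adj K x"
    using adjI[OF ideal_add[OF K], of k l "r + s" x] by (simp add: algebra_simps)
next
  fix a assume "a \<in> adj K x"
  then obtain k r where "k \<in> K" "a = k + r * x" by (auto elim!: adjE)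
  then show "- a \<in> adj K x"
    using adjI[OF ideal_uminus[OF K], of k "- r" x] by (simp add: algebra_simps)
next
  fix c a assume "a \<in> adj K x"
  then obtain k r where "k \<in> K" "a = k + r * x" by (auto elim!: adjE)
  then show "c * a \<in> adj K x"
    using adjI[OF ideal_mult_left[OF K], of k c "c * r" x] by (simp add: algebra_simps)
qed simp

lemma adj_least: "ideal I \<Longrightarrow> K \<subseteq> I \<Longrightarrow> x \<in> I \<Longrightarrow> adj K x \<subseteq> I"
  by (auto elim!: adjE intro!: ideal_add ideal_mult_left)

lemma adj_commute:
  assumes K: "ideal K"
  shows "adj (adj K x) y = adj (adj K y) x"
proof -
  have "adj (adj K x) y \<subseteq> adj (adj K y) x" for x y
  proof (intro adj_least adj_ideal K)
    show "x \<in> adj (adj K y) x" using adj_mem[OF adj_ideal[OF K], of 1] by simp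
    show "y \<in> adj (adj K y) x"
      using adj_mem[OF K, of 1 y] adj_superset[of "adj K y" x] by auto
    show "K \<subseteq> adj (adj K y) x"
      using adj_superset by blast
  qed
  then show ?thesis by blast
qed

lemma adjs_ideal: "ideal K \<Longrightarrow> ideal (adjs K xs)"
  by (induction xs arbitrary: K) (auto intro: adj_ideal)

lemma adjs_adj: "ideal K \<Longrightarrow> adjs (adj K x) xs = adj (adjs K xs) x"
  by (induction xs arbitrary: K) (simp_all add: adj_commute[of _ x] adj_ideal)

lemma adjs_superset: "K \<subseteq> adjs K xs"
  by (induction xs arbitrary: K) (use adj_superset in fastforce)+

lemma adjs_least: "ideal I \<Longrightarrow> K \<subseteq> I \<Longrightarrow> set xs \<subseteq> I \<Longrightarrow> adjs K xs \<subseteq> I"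
  by (induction xs arbitrary: K) (simp_all add: adj_least)

lemma set_subset_adjs: "ideal K \<Longrightarrow> set xs \<subseteq> adjs K xs"
proof (induction xs arbitrary: K)
  case (Cons x xs)
  have "x \<in> adjs (adj K x) xs"
    using adj_mem[OF Cons.prems, of 1 x] adjs_superset[of "adj K x" xs] by auto
  then show ?case using Cons.IH[OF adj_ideal[OF Cons.prems]] by simp
qed simp

lemma adjs_eq_gen_ideal: "adjs {0} xs = gen_ideal UNIV (set xs)"
proof
  show "adjs {0} xs \<subseteq> gen_ideal UNIV (set xs)"
    by (intro adjs_least gen_ideal_ideal gen_ideal_superset) (simp add: ideal_zero gen_ideal_ideal)
  show "gen_ideal UNIV (set xs) \<subseteq> adjs {0} xs"
    by (intro gen_ideal_least adjs_ideal set_subset_adjs ideal_singleton_zero)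
qed

lemma regular_append: "regular K (xs @ ys) \<longleftrightarrow> regular K xs \<and> regular (adjs K xs) ys"
  by (induction xs arbitrary: K) auto

lemma reg_seq_iff_regular:
  "reg_seq UNIV (*) (UNIV :: 'a::comm_ring_1 set) xs \<longleftrightarrow> regular {0} xs \<and> adjs {0} xs \<noteq> UNIV"
proof -
  have "regular {0} xs \<longleftrightarrow> (\<forall>i<length xs. nzd (adjs {0} (take i xs)) (xs ! i))"
  proof (induction xs rule: rev_induct)
    case (snoc x xs)
    then show ?case by (auto simp: regular_append nth_append less_Suc_eq)
  qed simp
  then show ?thesis
    by (auto simp: reg_seq_def idmod_eq_gen_ideal adjs_eq_gen_ideal nzd_def)
qed

text \<open>Swapping two entries of a regular sequence normally relies on a local ring. Here the
  extra assumption \<open>nzd K b\<close> replaces it: a relation \<open>a * u = k + v * b\<close>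
  forces v into K + (a), after which a can be cancelled.\<close>

lemma nzd_exchange:
  assumes K: "ideal K" and a: "nzd K a" and b: "nzd K b" and ab: "nzd (adj K a) b"
  shows "nzd (adj K b) a"
  unfolding nzd_def
proof (intro allI impI)
  fix u assume "a * u \<in> adj K b"
  then obtain k v where k: "k \<in> K" "a * u = k + v * b" by (rule adjE)
  have "b * v = - k + u * a" using k by (simp add: algebra_simps)
  then have "b * v \<in> adj K a" using adjI[OF ideal_uminus[OF K k(1)]] by simp
  then have "v \<in> adj K a" by (rule nzdD[OF ab])
  then obtain l w where l: "l \<in> K" "v = l + w * a" by (rule adjE)
  have "a * (u - w * b) = k + b * l" using k l by (simp add: algebra_simps)
  then have "a * (u - w * b) \<in> K" using k l K by (simp add: ideal_add ideal_mult_left)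
  then have "u - w * b \<in> K" by (rule nzdD[OF a])
  then show "u \<in> adj K b" using adjI[of "u - w * b" K w b] by simp
qed

text \<open>All ideals K + (x_1, ..., x_i), from K itself up to the full sequence: the places that
  an element must pass when it is moved from the end of the sequence to its front.\<close>

fun prefix_ideals :: "'a::comm_ring_1 set \<Rightarrow> 'a list \<Rightarrow> 'a set set" where
  "prefix_ideals K [] = {K}"
| "prefix_ideals K (x # xs) = insert K (prefix_ideals (adj K x) xs)"

lemma finite_prefix_ideals: "finite (prefix_ideals K xs)"
  by (induction xs arbitrary: K) auto

lemma prefix_ideals_self: "K \<in> prefix_ideals K xs"
  by (cases xs) auto

lemma prefix_ideals_adjs: "adjs K xs \<in> prefix_ideals K xs"
  by (induction xs arbitrary: K) auto

lemma prefix_ideals_ideal: "ideal K \<Longrightarrow> L \<in> prefix_ideals K xs \<Longrightarrow> ideal L"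
  by (induction xs arbitrary: K) (auto intro: adj_ideal)

text \<open>The extra entry x serves the longest prefix: each prefix ideal has the next entry of
  \<open>xs @ [x]\<close> as a nonzerodivisor.\<close>

lemma prefix_ideals_nzd:
  "regular K (xs @ [x]) \<Longrightarrow> set (xs @ [x]) \<subseteq> A \<Longrightarrow> L \<in> prefix_ideals K xs \<Longrightarrow> \<exists>a\<in>A. nzd L a"
  by (induction xs arbitrary: K) auto

text \<open>\<open>z\<close> is carried past the entries of \<open>xs\<close> one at a time by
  \<open>nzd_exchange\<close>.\<close>

lemma regular_adj:
  "ideal K \<Longrightarrow> regular K xs \<Longrightarrow> (\<And>L. L \<in> prefix_ideals K xs \<Longrightarrow> nzd L z) \<Longrightarrow> regular (adj K z) xs"
proof (induction xs arbitrary: K)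
  case (Cons x xs)
  have "nzd (adj K z) x"
    using Cons.prems(2,3) prefix_ideals_self[of "adj K x" xs] by (auto intro: nzd_exchange[OF Cons.prems(1)])
  moreover have "regular (adj (adj K x) z) xs"
    using Cons.prems(2,3) by (auto intro: Cons.IH[OF adj_ideal[OF Cons.prems(1)]])
  ultimately show ?case using adj_commute[OF Cons.prems(1), of x z] by simp
qed simp

text \<open>For an ideal \<open>A\<close> this says \<open>Hom(R/A, R/K) \<noteq> 0\<close>.\<close>

definition has_socle :: "'a::comm_ring_1 set \<Rightarrow> 'a set \<Rightarrow> bool" where
  "has_socle A K \<longleftrightarrow> (\<exists>u. u \<notin> K \<and> (\<forall>a\<in>A. a * u \<in> K))"

text \<open>For an ideal A and a nonzerodivisor x in A, Hom(R/A, R/(K + (x))) is isomorphic to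
  Ext^1(R/A, R/K), which does not involve x. Explicitly, the socle element u modulo K + (x) goes to
  v = y u / x modulo K + (y), the division by x taking place modulo K.\<close>

lemma has_socle_exchange:
  assumes K: "ideal K" and x: "nzd K x" "x \<in> A" and y: "nzd K y" "y \<in> A"
    and "has_socle A (adj K x)"
  shows "has_socle A (adj K y)"
proof -
  obtain u where u: "u \<notin> adj K x" "\<And>a. a \<in> A \<Longrightarrow> a * u \<in> adj K x"
    using assms(6) by (auto simp: has_socle_def)
  obtain k v where kv: "k \<in> K" "y * u = k + v * x" using u(2)[OF y(2)] by (rule adjE)
  have "v \<notin> adj K y"
  proof
    assume "v \<in> adj K y"
    then obtain l w where l: "l \<in> K" "v = l + w * y" by (rule adjE)
    have "y * (u - w * x) = k + x * l" using kv l by (simp add: algebra_simps)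
    then have "y * (u - w * x) \<in> K" using kv l K by (simp add: ideal_add ideal_mult_left)
    then have "u - w * x \<in> K" by (rule nzdD[OF y(1)])
    then show False using u(1) adjI[of "u - w * x" K w x] by simp
  qed
  moreover have "a * v \<in> adj K y" if a: "a \<in> A" for a
  proof -
    obtain l t where l: "l \<in> K" "a * u = l + t * x" using u(2)[OF a] by (rule adjE)
    have "x * (a * v - t * y) = a * (y * u - k) - y * (a * u - l)"
      unfolding kv l by (simp add: algebra_simps)
    also have "\<dots> = y * l - a * k" by (simp add: algebra_simps)
    finally have "x * (a * v - t * y) \<in> K" using kv l K by (simp add: ideal_diff ideal_mult_left)
    then have "a * v - t * y \<in> K" by (rule nzdD[OF x(1)])
    then show ?thesis using adjI[of "a * v - t * y" K t y] by simp
  qed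
  ultimately show ?thesis by (auto simp: has_socle_def)
qed

text \<open>Both socle conditions express \<open>Ext\<^sup>n(R/A, R/K) \<noteq> 0\<close> for \<open>n = length xs\<close>. The two sequences
  are linked by replacing their last entries with a common nonzerodivisor and moving it to the front.\<close>

lemma has_socle_regular:
  assumes noeth: "noetherian_of (UNIV :: 'a::comm_ring_1 set)" and A: "ideal (A :: 'a set)"
  shows "ideal K \<Longrightarrow> length xs = length ys \<Longrightarrow> regular K xs \<Longrightarrow> regular K ys \<Longrightarrow>
    set xs \<subseteq> A \<Longrightarrow> set ys \<subseteq> A \<Longrightarrow> has_socle A (adjs K xs) \<Longrightarrow> has_socle A (adjs K ys)"
proof (induction "length xs" arbitrary: K xs ys)
  case 0
  then show ?case by simp
next
  case (Suc n)
  obtain xs' x where xs: "xs = xs' @ [x]" using Suc.hyps(2) by (cases xs rule: rev_cases) auto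
  obtain ys' y where ys: "ys = ys' @ [y]" using Suc.hyps(2) Suc.prems(2) by (cases ys rule: rev_cases) auto
  let ?\<K> = "prefix_ideals K xs' \<union> prefix_ideals K ys'"
  have "\<exists>z\<in>A. \<forall>L\<in>?\<K>. nzd L z"
  proof (rule common_nzd[OF noeth A])
    show "ideal L" if "L \<in> ?\<K>" for L using that prefix_ideals_ideal[OF Suc.prems(1)] by blast
    show "\<exists>a\<in>A. nzd L a" if "L \<in> ?\<K>" for L
      using that prefix_ideals_nzd[OF Suc.prems(3,5)[unfolded xs], of L]
        prefix_ideals_nzd[OF Suc.prems(4,6)[unfolded ys], of L] by (elim UnE)
  qed (simp add: finite_prefix_ideals)
  then obtain z where z: "z \<in> A" "\<And>L. L \<in> ?\<K> \<Longrightarrow> nzd L z" by blast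
  have z_nzd: "nzd (adjs K xs') z" "nzd (adjs K ys') z"
    using z(2) prefix_ideals_adjs by blast+
  have x: "nzd (adjs K xs') x" "x \<in> A" "nzd (adjs K ys') y" "y \<in> A"
    using Suc.prems(3-6) by (auto simp: xs ys regular_append)
  have "has_socle A (adj (adjs K xs') z)"
    using has_socle_exchange[OF adjs_ideal[OF Suc.prems(1)] x(1,2) z_nzd(1) z(1)] Suc.prems(7) by (simp add: xs)
  then have "has_socle A (adjs (adj K z) xs')" by (simp add: adjs_adj Suc.prems)
  moreover have "regular (adj K z) xs'" "regular (adj K z) ys'"
    using Suc.prems(3,4) z(2) by (auto simp: xs ys regular_append intro!: regular_adj[OF Suc.prems(1)])
  ultimately have "has_socle A (adjs (adj K z) ys')"
    using Suc.prems(2,5,6) Suc.hyps(2) Suc.hyps(1)[OF _ adj_ideal[OF Suc.prems(1)], of xs' ys'] by (simp add: xs ys)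
  then have "has_socle A (adj (adjs K ys') z)" by (simp add: adjs_adj Suc.prems)
  then show ?case
    using has_socle_exchange[OF adjs_ideal[OF Suc.prems(1)] z_nzd(2) z(1) x(3,4)] by (simp add: ys)
qed

text \<open>Rees' theorem in the form used below. The entry of \<open>xs\<close> at position
  \<open>length ys\<close> shows that the quotient by the earlier entries has no socle. By
  \<open>has_socle_regular\<close> the quotient by \<open>ys\<close> has none either, so A lies in
  no maximal colon and prime avoidance supplies a further entry.\<close>

lemma regular_extend:
  assumes noeth: "noetherian_of (UNIV :: 'a::comm_ring_1 set)" and A: "ideal (A :: 'a set)"
    and K: "ideal K" and xs: "regular K xs" "set xs \<subseteq> A" and ys: "regular K ys" "set ys \<subseteq> A"
    and "length ys \<le> length xs"
  obtains zs where "regular (adjs K ys) zs" "set zs \<subseteq> A" "length ys + length zs = length xs"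
proof -
  have "\<exists>zs. regular K (ys @ zs) \<and> set zs \<subseteq> A \<and> length ys + length zs = length xs"
    using ys \<open>length ys \<le> length xs\<close>
  proof (induction "length xs - length ys" arbitrary: ys)
    case 0
    then show ?case by (intro exI[of _ "[]"]) simp
  next
    case (Suc n)
    define xs1 where "xs1 = take (length ys) xs"
    define x where "x = xs ! length ys"
    have "length ys < length xs" using Suc by simp
    then have split: "xs = (xs1 @ [x]) @ drop (Suc (length ys)) xs" "length xs1 = length ys"
      unfolding xs1_def x_def by (simp_all add: id_take_nth_drop)
    then have xs1: "regular K xs1" "nzd (adjs K xs1) x" "set xs1 \<subseteq> A" "x \<in> A"
      using xs by (metis regular_append regular.simps(2), metis regular_append regular.simps(2) adjs_simps(3),
          metis le_sup_iff set_append, metis Un_iff in_set_conv_decomp set_append subsetD)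
    then have "\<not> has_socle A (adjs K xs1)" by (auto simp: has_socle_def nzd_def)
    then have no: "\<not> has_socle A (adjs K ys)"
      using has_socle_regular[OF noeth A K, of ys xs1] split(2) xs1 Suc.prems by auto
    have idl: "ideal (adjs K ys)" using adjs_ideal[OF K] .
    have "\<exists>z\<in>A. z \<notin> \<Union> (maximal_colons (adjs K ys))"
    proof (rule ideal_prime_avoidance[OF A])
      show "finite (maximal_colons (adjs K ys))" by (rule finite_maximal_colons[OF noeth idl])
      show "prime_ideal P" if "P \<in> maximal_colons (adjs K ys)" for P
        using maximal_colons_prime[OF idl that] .
      show "\<not> A \<subseteq> P" if "P \<in> maximal_colons (adjs K ys)" for P
        using no that by (auto simp: has_socle_def maximal_colons_def colon_def)
    qed
    then obtain z where z: "z \<in> A" "nzd (adjs K ys) z" using nzd_iff_maximal_colons[OF noeth idl] by blast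
    have "\<exists>zs. regular K ((ys @ [z]) @ zs) \<and> set zs \<subseteq> A \<and> length (ys @ [z]) + length zs = length xs"
    proof (rule Suc.hyps(1))
      show "n = length xs - length (ys @ [z])" "length (ys @ [z]) \<le> length xs"
        using Suc.hyps(2) by simp_all
      show "regular K (ys @ [z])" "set (ys @ [z]) \<subseteq> A"
        using Suc.prems(1,2) z by (simp_all add: regular_append)
    qed
    then obtain zs where zs: "regular K ((ys @ [z]) @ zs)" "set zs \<subseteq> A"
        "length (ys @ [z]) + length zs = length xs" by blast
    then show ?case using z by (intro exI[of _ "z # zs"]) auto
  qed
  then show thesis using that by (auto simp: regular_append)
qed

section \<open>Chains of primes above an associated prime\<close>

text \<open>For an ideal K and a multiplicative set W, this is the preimage in R of the extension of
  K to the localisation at W.\<close>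

definition sat :: "'a::comm_ring_1 set \<Rightarrow> 'a set \<Rightarrow> 'a set" where
  "sat W K = {y. \<exists>w\<in>W. w * y \<in> K}"

locale mult_set =
  fixes W :: "'a::comm_ring_1 set"
  assumes one_mem: "1 \<in> W" and mult_mem: "v \<in> W \<Longrightarrow> w \<in> W \<Longrightarrow> v * w \<in> W"
begin

lemma sat_superset: "K \<subseteq> sat W K"
proof
  fix y assume "y \<in> K"
  then have "1 * y \<in> K" by simp
  then show "y \<in> sat W K" using one_mem unfolding sat_def by blast
qed

lemma sat_sat: "sat W (sat W K) = sat W K"
proof (intro equalityI sat_superset subsetI)
  fix y assume "y \<in> sat W (sat W K)"
  then obtain v w where "v \<in> W" "w \<in> W" "(v * w) * y \<in> K" by (auto simp: sat_def mult.assoc)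
  then show "y \<in> sat W K" using mult_mem by (auto simp: sat_def)
qed

lemma sat_ideal:
  assumes K: "ideal K"
  shows "ideal (sat W K)"
  unfolding ideal_of_def
proof (intro conjI ballI)
  show "0 \<in> sat W K" using sat_superset ideal_zero[OF K] by blast
next
  fix a b assume "a \<in> sat W K" "b \<in> sat W K"
  then obtain v w where "v \<in> W" "v * a \<in> K" "w \<in> W" "w * b \<in> K" by (auto simp: sat_def)
  moreover have "(v * w) * (a + b) = w * (v * a) + v * (w * b)" by (simp add: algebra_simps)
  ultimately have "v * w \<in> W" "(v * w) * (a + b) \<in> K"
    using K mult_mem by (auto intro: ideal_add ideal_mult_left)
  then show "a + b \<in> sat W K" by (auto simp: sat_def)
next
  fix a assume "a \<in> sat W K"
  then show "- a \<in> sat W K" using ideal_uminus[OF K] by (fastforce simp: sat_def)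
next
  fix r a assume "a \<in> sat W K"
  then show "r * a \<in> sat W K" using ideal_mult_left[OF K, of _ r] by (auto simp: sat_def mult.left_commute[of _ r])
qed simp

lemma sat_mono: "K \<subseteq> L \<Longrightarrow> sat W K \<subseteq> sat W L"
  by (auto simp: sat_def)

lemma nzd_sat: "nzd K x \<Longrightarrow> nzd (sat W K) x"
  unfolding nzd_def sat_def mem_Collect_eq by (metis mult.left_commute)

text \<open>A form of Nakayama's lemma over the localisation at \<open>W\<close>, where the assumption reads
  \<open>F \<subseteq> T + x F\<close>. It serves both for \<open>x\<close> in the Jacobson radical and for \<open>x\<close> generating a prime.\<close>

lemma nakayama:
  assumes noeth: "noetherian_of (UNIV :: 'a set)" and T: "ideal T" and "F \<noteq> {}"
    and step: "\<And>y. y \<in> F \<Longrightarrow> \<exists>w\<in>W. \<exists>y'\<in>F. w * y - x * y' \<in> T"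
  shows "\<exists>y\<in>F. \<exists>w\<in>W. \<exists>r. (w - r * x) * y \<in> T"
proof -
  \<comment> \<open>Choose y in F with \<open>sat W (adj T y)\<close> maximal. The assumption makes
    y a multiple of y' modulo T over the localisation; maximality makes y' a multiple of y as well,
    and combining the two relations gives the claim for y'.\<close>
  let ?\<A> = "(\<lambda>y. sat W (adj T y)) ` F"
  obtain I where "I \<in> ?\<A>" and I: "\<And>J. J \<in> ?\<A> \<Longrightarrow> I \<subseteq> J \<Longrightarrow> J = I"
    using noetherian_maximal[OF noeth, of ?\<A>] \<open>F \<noteq> {}\<close> sat_ideal adj_ideal[OF T] by blast
  then obtain y where y: "y \<in> F" "I = sat W (adj T y)" by blast
  obtain w y' where w: "w \<in> W" "y' \<in> F" "w * y - x * y' \<in> T" using step[OF y(1)] by blast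
  have "w * y \<in> adj T y'" using adjI[OF w(3), of x y'] by simp
  then have "y \<in> sat W (adj T y')" using w(1) by (auto simp: sat_def)
  then have "adj T y \<subseteq> sat W (adj T y')"
    by (intro adj_least sat_ideal adj_ideal T) (use adj_superset sat_superset in blast)+
  then have "I \<subseteq> sat W (adj T y')"
    using sat_mono sat_sat unfolding y(2) by blast
  then have "sat W (adj T y') = I" using w(2) by (intro I) auto
  moreover have "y' \<in> sat W (adj T y')" using adj_mem[OF T, of 1 y'] sat_superset by auto
  ultimately obtain v where v: "v \<in> W" "v * y' \<in> adj T y" using y(2) by (auto simp: sat_def)
  then obtain t r where t: "t \<in> T" "v * y' = t + r * y" by (auto elim!: adjE)
  have "(w * v - r * x) * y' = w * (v * y') - r * (x * y')" by (simp add: algebra_simps)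
  also have "\<dots> = w * t + r * (w * y - x * y')" unfolding t by (simp add: algebra_simps)
  finally have "(w * v - r * x) * y' \<in> T" using T t w by (simp add: ideal_add ideal_mult_left)
  then show ?thesis using w v mult_mem by blast
qed

end

locale noetherian_at_prime =
  fixes m :: "'a::comm_ring_1 set"
  assumes noeth: "noetherian_of (UNIV :: 'a set)" and m: "prime_ideal m"
begin

sublocale mult_set "- m"
  using prime_ideal_one[OF m] prime_ideal_mult[OF m] by unfold_locales auto

text \<open>This is the inequality depth <= dim R/P for an associated prime P, localised at m. Each
  entry x of the sequence forces a strictly larger prime, associated to the next quotient: it
  contains P and x, and x is outside P because x is a nonzerodivisor.\<close>

lemma chain_above_associated:
  assumes "ideal K" and "regular K zs" and "set zs \<subseteq> m" and "prime_ideal P"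
    and "u \<notin> sat (- m) K" and "P = colon (sat (- m) K) u"
  shows "\<exists>Q. Q 0 = P \<and> (\<forall>i\<le>length zs. prime_ideal (Q i)) \<and> (\<forall>i<length zs. Q i \<subset> Q (Suc i))"
  using assms
proof (induction zs arbitrary: K P u)
  case Nil
  then show ?case by (intro exI[of _ "\<lambda>_. P"]) simp
next
  case (Cons x zs)
  define S where "S = sat (- m) K"
  define S' where "S' = sat (- m) (adj K x)"
  note K = Cons.prems(1)
  have S: "ideal S" "ideal S'" "S \<subseteq> S'"
    unfolding S_def S'_def by (auto intro!: sat_ideal adj_ideal K sat_mono adj_superset)
  have satS: "sat (- m) S = S" "sat (- m) S' = S'"
    unfolding S_def S'_def by (simp_all add: sat_sat)
  have x: "nzd K x" "nzd S x" "x \<in> m" using Cons.prems nzd_sat by (auto simp: S_def)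
  \<comment> \<open>The nonzero elements killed by P modulo S. One of them must survive modulo x for
    its annihilator to contain both P and x.\<close>
  define F where "F = {y. (\<forall>p\<in>P. p * y \<in> S) \<and> y \<notin> S}"
  have "u \<in> F" using Cons.prems(5,6) by (auto simp: F_def S_def colon_def)
  have "\<exists>y\<in>F. y \<notin> S'"
  \<comment> \<open>Otherwise every element of F is, over the localisation at m, x times some y'
    modulo S. As x is a nonzerodivisor modulo S, y' is again in F, and Nakayama's lemma applies
    because x lies in m.\<close>
  proof (rule ccontr)
    assume no: "\<not> (\<exists>y\<in>F. y \<notin> S')"
    have "\<exists>y\<in>F. \<exists>w\<in>-m. \<exists>r. (w - r * x) * y \<in> S"
    proof (rule nakayama[OF noeth S(1)])
      fix y assume y: "y \<in> F"
      then obtain w where w: "w \<in> - m" "w * y \<in> adj K x" using no by (auto simp: S'_def sat_def)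
      then obtain k y' where k: "k \<in> K" "w * y = k + y' * x" by (auto elim!: adjE)
      have kS: "k \<in> S" using k sat_superset by (auto simp: S_def)
      have "x * (p * y') = w * (p * y) - p * k" for p using k(2) by (simp add: algebra_simps)
      then have "p * y' \<in> S" if "p \<in> P" for p
        using that y kS S(1) x(2) by (metis (mono_tags, lifting) F_def mem_Collect_eq ideal_diff ideal_mult_left nzdD)
      moreover have "y' \<notin> S"
      proof
        assume "y' \<in> S"
        then have "w * y \<in> S" using k kS S(1) by (simp add: ideal_add ideal_mult_right)
        then have "y \<in> S" using satS(1) w(1) by (auto simp: sat_def)
        then show False using y by (simp add: F_def)
      qed
      moreover have "w * y - x * y' \<in> S" using k kS by (simp add: mult.commute)
      ultimately show "\<exists>w\<in>-m. \<exists>y'\<in>F. w * y - x * y' \<in> S" using w by (auto simp: F_def)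
    qed (use \<open>u \<in> F\<close> in auto)
    then obtain y w r where y: "y \<in> F" "w \<notin> m" "(w - r * x) * y \<in> S" by auto
    have "w - r * x \<notin> m"
    proof
      assume "w - r * x \<in> m"
      then have "(w - r * x) + r * x \<in> m"
        using x(3) prime_ideal_ideal[OF m] by (intro ideal_add ideal_mult_left) auto
      then show False using y by simp
    qed
    then have "y \<in> S" using y satS(1) by (auto simp: sat_def)
    then show False using y by (simp add: F_def)
  qed
  then obtain y where y: "y \<in> F" "y \<notin> S'" by blast
  obtain v where v: "v \<notin> S'" "colon S' y \<subseteq> colon S' v" "colon S' v \<in> maximal_colons S'"
    using colon_subset_maximal[OF noeth S(2) y(2)] by blast
  have prime: "prime_ideal (colon S' v)" using maximal_colons_prime[OF S(2) v(3)] .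
  have "P \<subseteq> colon S' y" using y S(3) by (auto simp: F_def colon_def)
  moreover have "x \<in> colon S' y"
    using adj_mem[OF K, of y x] sat_superset[of "adj K x"] by (auto simp: colon_def S'_def mult.commute)
  moreover have "x \<notin> P"
    using Cons.prems(5,6) x(2) by (auto simp: colon_def S_def nzd_def)
  ultimately have "P \<subset> colon S' v" using v(2) by blast
  have "\<exists>Q. Q 0 = colon S' v \<and> (\<forall>i\<le>length zs. prime_ideal (Q i)) \<and> (\<forall>i<length zs. Q i \<subset> Q (Suc i))"
    using Cons.prems(2,3) v(1) by (intro Cons.IH[OF adj_ideal[OF K] _ _ prime]) (simp_all add: S'_def)
  then obtain Q where Q: "Q 0 = colon S' v" "\<forall>i\<le>length zs. prime_ideal (Q i)"
      "\<forall>i<length zs. Q i \<subset> Q (Suc i)" by (elim exE conjE)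
  define Q' where "Q' = case_nat P Q"
  have "prime_ideal (Q' i)" if "i \<le> length (x # zs)" for i
    using that Q(2) Cons.prems(4) by (cases i) (simp_all add: Q'_def)
  moreover have "Q' i \<subset> Q' (Suc i)" if "i < length (x # zs)" for i
    using that Q(1,3) \<open>P \<subset> colon S' v\<close> by (cases i) (simp_all add: Q'_def)
  moreover have "Q' 0 = P" by (simp add: Q'_def)
  ultimately show ?case by blast
qed

end

section \<open>Homogeneous components\<close>

definition hcomp :: "(nat \<Rightarrow> 'b::ab_group_add set) \<Rightarrow> 'b \<Rightarrow> nat \<Rightarrow> 'b" where
  "hcomp G x = (THE c. (\<forall>n. c n \<in> G n) \<and> finite {n. c n \<noteq> 0} \<and> x = (\<Sum>n\<in>{n. c n \<noteq> 0}. c n))"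

locale graded_group =
  fixes G :: "nat \<Rightarrow> 'b::ab_group_add set"
  assumes decomp: "graded_decomp G"
begin

abbreviation comp :: "'b \<Rightarrow> nat \<Rightarrow> 'b" where
  "comp \<equiv> hcomp G"

lemma zero_mem: "0 \<in> G n"
  and add_mem: "a \<in> G n \<Longrightarrow> b \<in> G n \<Longrightarrow> a + b \<in> G n"
  and uminus_mem: "a \<in> G n \<Longrightarrow> - a \<in> G n"
  using decomp by (simp_all add: graded_decomp_def)

lemma ex1_comp: "\<exists>!c. (\<forall>n. c n \<in> G n) \<and> finite {n. c n \<noteq> 0} \<and> x = (\<Sum>n\<in>{n. c n \<noteq> 0}. c n)"
  using decomp unfolding graded_decomp_def by simp

lemma comp_props:
  "(\<forall>n. comp x n \<in> G n) \<and> finite {n. comp x n \<noteq> 0} \<and> x = (\<Sum>n\<in>{n. comp x n \<noteq> 0}. comp x n)"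
  unfolding hcomp_def by (rule theI'[OF ex1_comp])

lemma comp_mem: "comp x n \<in> G n"
  and finite_comp: "finite {n. comp x n \<noteq> 0}"
  using comp_props by blast+

lemma comp_unique:
  assumes "finite F" and "\<And>n. c n \<in> G n" and "\<And>n. n \<notin> F \<Longrightarrow> c n = 0" and "x = (\<Sum>n\<in>F. c n)"
  shows "comp x = c"
proof -
  have sub: "{n. c n \<noteq> 0} \<subseteq> F" using assms(3) by blast
  have "(\<forall>n. c n \<in> G n) \<and> finite {n. c n \<noteq> 0} \<and> x = (\<Sum>n\<in>{n. c n \<noteq> 0}. c n)"
  proof (intro conjI allI)
    show "finite {n. c n \<noteq> 0}" using finite_subset[OF sub assms(1)] .
    show "x = (\<Sum>n\<in>{n. c n \<noteq> 0}. c n)"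
      unfolding assms(4) using sub assms(1) by (intro sum.mono_neutral_right) auto
  qed (rule assms(2))
  then show ?thesis unfolding hcomp_def by (rule the1_equality[OF ex1_comp])
qed

lemma sum_comp:
  assumes "finite F" and "{n. comp x n \<noteq> 0} \<subseteq> F"
  shows "(\<Sum>n\<in>F. comp x n) = x"
proof -
  have "(\<Sum>n\<in>F. comp x n) = (\<Sum>n\<in>{n. comp x n \<noteq> 0}. comp x n)"
    using assms by (intro sum.mono_neutral_right) auto
  then show ?thesis using comp_props[of x] by simp
qed

lemma comp_add: "comp (x + y) n = comp x n + comp y n"
proof -
  let ?F = "{n. comp x n \<noteq> 0} \<union> {n. comp y n \<noteq> 0}"
  have "comp (x + y) = (\<lambda>n. comp x n + comp y n)"
  proof (rule comp_unique[of ?F])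
    show "finite ?F" by (simp add: finite_comp)
    then show "x + y = (\<Sum>n\<in>?F. comp x n + comp y n)"
      by (simp only: sum.distrib) (simp add: sum_comp)
  qed (auto intro: add_mem comp_mem)
  then show ?thesis by simp
qed

lemma comp_homogeneous:
  assumes "x \<in> G d"
  shows "comp x n = (if n = d then x else 0)"
proof -
  have "comp x = (\<lambda>n. if n = d then x else 0)"
    using assms by (intro comp_unique[of "{d}"]) (auto simp: zero_mem)
  then show ?thesis by simp
qed

lemma comp_zero [simp]: "comp 0 n = 0"
  using comp_homogeneous[OF zero_mem[of 0], of n] by simp

lemma comp_diff: "comp (x - y) n = comp x n - comp y n"
  using comp_add[of "x - y" y n] by simp

lemma comp_uminus: "comp (- x) n = - comp x n"
  using comp_diff[of 0 x n] by simp

lemma comp_sum: "comp (sum f F) n = (\<Sum>i\<in>F. comp (f i) n)"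
  by (induction F rule: infinite_finite_induct) (simp_all add: comp_add)

lemma comp_bounded: "\<exists>N. \<forall>n>N. comp x n = 0"
proof (intro exI allI impI)
  fix n assume "n > Max (insert 0 {n. comp x n \<noteq> 0})"
  then have "n \<notin> {n. comp x n \<noteq> 0}" using Max_ge[of "insert 0 {n. comp x n \<noteq> 0}" n] finite_comp[of x] by auto
  then show "comp x n = 0" by simp
qed

lemma bounded_decomp:
  obtains N where "\<And>n. n > N \<Longrightarrow> comp x n = 0" "x = (\<Sum>n\<le>N. comp x n)"
proof -
  obtain N where N: "\<And>n. n > N \<Longrightarrow> comp x n = 0" using comp_bounded[of x] by blast
  have "n \<le> N" if "comp x n \<noteq> 0" for n
    using N[of n] that by (meson not_le)
  then have "(\<Sum>n\<le>N. comp x n) = x"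
    by (intro sum_comp) auto
  from that[OF N this[symmetric]] show thesis .
qed

end

section \<open>Graded rings and homogeneous parts of ideals\<close>

locale graded_ring =
  fixes R :: "nat \<Rightarrow> 'a::comm_ring_1 set"
  assumes decomp: "graded_decomp R" and one: "1 \<in> R 0"
    and mult: "a \<in> R i \<Longrightarrow> b \<in> R j \<Longrightarrow> a * b \<in> R (i + j)"
begin

sublocale graded_group R
  by unfold_locales (rule decomp)

lemma comp_mult_homogeneous:
  assumes "h \<in> R d"
  shows "comp (h * x) n = (if d \<le> n then h * comp x (n - d) else 0)"
proof -
  obtain N where N: "\<And>n. n > N \<Longrightarrow> comp x n = 0" "x = (\<Sum>n\<le>N. comp x n)"
    using bounded_decomp[of x] by blast
  have "comp (h * x) n = comp (\<Sum>i\<le>N. h * comp x i) n"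
    by (subst N(2)) (simp add: sum_distrib_left)
  also have "\<dots> = (\<Sum>i\<le>N. if n = d + i then h * comp x i else 0)"
    unfolding comp_sum
    by (intro sum.cong refl) (simp add: comp_homogeneous[OF mult[OF assms comp_mem]])
  also have "\<dots> = (if d \<le> n then h * comp x (n - d) else 0)"
  proof (cases "d \<le> n \<and> n - d \<le> N")
    case True
    then have "(\<Sum>i\<le>N. if n = d + i then h * comp x i else 0) = (\<Sum>i\<in>{n - d}. h * comp x i)"
      by (intro sum.mono_neutral_cong_right) auto
    then show ?thesis using True by simp
  next
    case False
    then have "(\<Sum>i\<le>N. if n = d + i then h * comp x i else 0) = 0"
      by (intro sum.neutral) auto
    then show ?thesis using False N(1)[of "n - d"] by auto
  qed
  finally show ?thesis .
qed

lemma comp_mult: "comp (x * y) n = (\<Sum>i\<le>n. comp x i * comp y (n - i))"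
proof -
  obtain N where N: "\<And>n. n > N \<Longrightarrow> comp x n = 0" "x = (\<Sum>n\<le>N. comp x n)"
    using bounded_decomp[of x] by blast
  have "comp (x * y) n = comp (\<Sum>i\<le>N. comp x i * y) n"
    by (subst N(2)) (simp add: sum_distrib_right)
  also have "\<dots> = (\<Sum>i\<le>N. if i \<le> n then comp x i * comp y (n - i) else 0)"
    unfolding comp_sum by (intro sum.cong refl) (simp add: comp_mult_homogeneous[OF comp_mem])
  also have "\<dots> = (\<Sum>i\<in>{..N} \<inter> {..n}. comp x i * comp y (n - i))"
    by (intro sum.mono_neutral_cong_right) auto
  also have "\<dots> = (\<Sum>i\<le>n. comp x i * comp y (n - i))"
  proof (intro sum.mono_neutral_left ballI)
    fix i assume "i \<in> {..n} - {..N} \<inter> {..n}"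
    then show "comp x i * comp y (n - i) = 0" using N(1)[of i] by auto
  qed auto
  finally show ?thesis .
qed

lemma comp_mult_zero: "comp (x * y) 0 = comp x 0 * comp y 0"
  by (simp add: comp_mult)

text \<open>For an ideal Q this is the largest homogeneous ideal contained in Q, usually written Q*.
  The equation \<open>star K = K\<close> expresses that K is homogeneous.\<close>

definition star :: "'a set \<Rightarrow> 'a set" where
  "star Q = {x. \<forall>n. comp x n \<in> Q}"

lemma star_subset:
  assumes "ideal Q"
  shows "star Q \<subseteq> Q"
proof
  fix x assume x: "x \<in> star Q"
  have "(\<Sum>n\<in>{n. comp x n \<noteq> 0}. comp x n) \<in> Q" using x by (intro ideal_sum assms) (simp add: star_def)
  then show "x \<in> Q" using comp_props[of x] by simp
qed

lemma star_homogeneous: "ideal Q \<Longrightarrow> x \<in> R n \<Longrightarrow> x \<in> star Q \<longleftrightarrow> x \<in> Q"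
  by (auto simp: star_def comp_homogeneous ideal_zero)

lemma star_mono: "P \<subseteq> Q \<Longrightarrow> star P \<subseteq> star Q"
  by (auto simp: star_def)

lemma star_ideal:
  assumes Q: "ideal Q"
  shows "ideal (star Q)"
proof -
  have "comp (r * x) n \<in> Q" if "\<forall>n. comp x n \<in> Q" for r x n
    unfolding comp_mult using that by (intro ideal_sum Q) (simp add: ideal_mult_left[OF Q])
  then show ?thesis
    unfolding star_def ideal_of_def[of _ "{x. \<forall>n. comp x n \<in> Q}"]
    by (simp add: comp_add comp_uminus ideal_zero[OF Q] ideal_add[OF Q] ideal_uminus[OF Q])
qed

text \<open>Take the lowest components of a and b that lie outside Q, in degrees i and j. In degree
  i + j of the product every other term contains a factor in Q.\<close>

lemma star_prime:
  assumes Q: "prime_ideal Q"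
  shows "prime_ideal (star Q)"
proof -
  note iQ = prime_ideal_ideal[OF Q]
  have "1 \<notin> star Q" using star_subset[OF iQ] prime_ideal_one[OF Q] by blast
  moreover have "a \<in> star Q \<or> b \<in> star Q" if ab: "a * b \<in> star Q" for a b
  proof (rule ccontr)
    assume no: "\<not> (a \<in> star Q \<or> b \<in> star Q)"
    define i where "i = (LEAST i. comp a i \<notin> Q)"
    define j where "j = (LEAST j. comp b j \<notin> Q)"
    have "\<exists>i. comp a i \<notin> Q" "\<exists>j. comp b j \<notin> Q" using no by (auto simp: star_def)
    then have i: "comp a i \<notin> Q" and j: "comp b j \<notin> Q"
      unfolding i_def j_def
      using LeastI_ex[of "\<lambda>i. comp a i \<notin> Q"] LeastI_ex[of "\<lambda>j. comp b j \<notin> Q"] by blast+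
    have i': "comp a k \<in> Q" if "k < i" for k using that not_less_Least unfolding i_def by blast
    have j': "comp b k \<in> Q" if "k < j" for k using that not_less_Least unfolding j_def by blast
    have "comp (a * b) (i + j) = comp a i * comp b j + (\<Sum>k\<in>{..i+j} - {i}. comp a k * comp b (i + j - k))"
      unfolding comp_mult
      using sum.remove[of "{..i+j}" i "\<lambda>k. comp a k * comp b (i + j - k)"] by simp
    moreover have "(\<Sum>k\<in>{..i+j} - {i}. comp a k * comp b (i + j - k)) \<in> Q"
    proof (intro ideal_sum iQ)
      fix k assume "k \<in> {..i+j} - {i}"
      then have "k < i \<or> i + j - k < j" by auto
      then show "comp a k * comp b (i + j - k) \<in> Q"
        using ideal_mult_right[OF iQ i'] ideal_mult_left[OF iQ j'] by blast
    qed
    moreover have "comp (a * b) (i + j) \<in> Q" using ab by (simp add: star_def)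
    ultimately have "comp a i * comp b j \<in> Q" using ideal_diff[OF iQ] by (metis add_diff_cancel_right')
    then show False using prime_ideal_mult[OF Q] i j by blast
  qed
  ultimately show ?thesis using star_ideal[OF iQ] by (simp add: prime_of_def)
qed

lemma homogeneous_adj:
  assumes K: "ideal K" "star K = K" and x: "x \<in> R d"
  shows "star (adj K x) = adj K x"
proof (rule equalityI[OF star_subset[OF adj_ideal[OF K(1)]]], rule subsetI)
  fix y assume "y \<in> adj K x"
  then obtain k r where k: "k \<in> K" "y = k + x * r" by (auto elim!: adjE simp: mult.commute)
  have kn: "comp k n \<in> K" for n using k(1) K(2) by (auto simp: star_def)
  have "comp y n = comp k n + (if d \<le> n then comp r (n - d) else 0) * x" for n
    unfolding k(2) comp_add comp_mult_homogeneous[OF x] by (simp add: mult.commute)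
  then show "y \<in> star (adj K x)" using adjI[OF kn] by (simp add: star_def)
qed

lemma homogeneous_adjs:
  "ideal K \<Longrightarrow> star K = K \<Longrightarrow> (\<And>x. x \<in> set xs \<Longrightarrow> \<exists>d. x \<in> R d) \<Longrightarrow> star (adjs K xs) = adjs K xs"
proof (induction xs arbitrary: K)
  case (Cons x xs)
  obtain d where "x \<in> R d" using Cons.prems(3)[of x] by auto
  then show ?case
    using Cons.IH[OF adj_ideal[OF Cons.prems(1)] homogeneous_adj[OF Cons.prems(1,2)]] Cons.prems(3) by simp
qed simp

section \<open>Inhomogeneous primes\<close>

text \<open>Modulo \<open>star Q\<close> and after inverting the homogeneous elements outside \<open>Q\<close>, an element of \<open>Q\<close>
  whose components spread over the shortest possible interval of degrees divides all of \<open>Q\<close>,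
  by division with remainder. So \<open>Q\<close> becomes principal, and a smaller prime \<open>P\<close> not containing the
  generator \<open>f\<close> satisfies \<open>P = f P\<close>.\<close>

definition spread_le :: "'a set \<Rightarrow> 'a \<Rightarrow> nat \<Rightarrow> bool" where
  "spread_le Q g s \<longleftrightarrow> (\<exists>n. \<forall>i. comp g i \<notin> Q \<longrightarrow> i \<le> n \<and> n \<le> i + s)"

lemma ex_spread_le:
  assumes "ideal Q"
  shows "\<exists>s. spread_le Q g s"
proof -
  obtain N where "\<And>n. n > N \<Longrightarrow> comp g n = 0" using comp_bounded[of g] by blast
  then have "spread_le Q g N"
    unfolding spread_le_def using ideal_zero[OF assms] by (metis le_add2 not_le)
  then show ?thesis ..
qed

text \<open>The interval is moved so that it ends at the highest component outside Q, which then
  serves as leading coefficient in the division.\<close>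

lemma spread_le_top:
  assumes Q: "ideal Q" and "spread_le Q g s" and "g \<notin> star Q"
  obtains n where "comp g n \<notin> Q" "\<And>i. comp g i \<notin> Q \<Longrightarrow> i \<le> n \<and> n \<le> i + s"
proof -
  obtain n where n: "\<And>i. comp g i \<notin> Q \<Longrightarrow> i \<le> n \<and> n \<le> i + s" using assms(2) by (auto simp: spread_le_def)
  let ?S = "{i. comp g i \<notin> Q}"
  have fin: "finite ?S" using n by (intro finite_subset[of ?S "{..n}"]) auto
  have ne: "?S \<noteq> {}" using assms(3) by (auto simp: star_def)
  have "Max ?S \<in> ?S" using Max_in[OF fin ne] .
  moreover have "i \<le> Max ?S \<and> Max ?S \<le> i + s" if "comp g i \<notin> Q" for i
    using Max_ge[OF fin, of i] n[OF that] n[of "Max ?S"] \<open>Max ?S \<in> ?S\<close> that by auto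
  ultimately show thesis using that by blast
qed

text \<open>Consequently a chain of primes sharing the same \<open>star\<close> has at most two
  members, the homogeneous prime itself and one inhomogeneous prime above it.\<close>

lemma no_prime_between_star:
  assumes noeth: "noetherian_of (UNIV :: 'a set)"
    and P: "prime_ideal P" and Q: "prime_ideal Q" and "P \<subseteq> Q"
    and star: "star P = star Q" and "star P \<noteq> P"
  shows "P = Q"
proof -
  define T where "T = star Q"
  define W where "W = {h. (\<exists>n. h \<in> R n) \<and> h \<notin> T}"
  note iP = prime_ideal_ideal[OF P] and iQ = prime_ideal_ideal[OF Q]
  have T: "prime_ideal T" unfolding T_def by (rule star_prime[OF Q])
  note iT = prime_ideal_ideal[OF T]
  have TP: "T \<subseteq> P" using star_subset[OF iP] star by (simp add: T_def)
  have TQ: "T \<subseteq> Q" using TP assms(4) by blast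
  have W_P: "h \<notin> P" if "h \<in> W" for h
    using that star_homogeneous[OF iP] star by (auto simp: W_def T_def)
  have W_Q: "h \<notin> Q" if "h \<in> W" for h
    using that star_homogeneous[OF iQ] by (auto simp: W_def T_def)
  interpret W: mult_set W
  proof
    show "1 \<in> W" using one prime_ideal_one[OF T] by (auto simp: W_def)
    show "v * w \<in> W" if "v \<in> W" "w \<in> W" for v w
      using that mult prime_ideal_mult[OF T] unfolding W_def by blast
  qed
  have "\<exists>s. \<exists>f. f \<in> Q \<and> f \<notin> T \<and> spread_le Q f s"
    using TP assms(4,6) star ex_spread_le[OF iQ] unfolding T_def by blast
  then obtain s where s: "\<exists>f. f \<in> Q \<and> f \<notin> T \<and> spread_le Q f s"
    and min: "\<And>s'. s' < s \<Longrightarrow> \<not> (\<exists>f. f \<in> Q \<and> f \<notin> T \<and> spread_le Q f s')"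
    using exists_least_iff[of "\<lambda>s. \<exists>f. f \<in> Q \<and> f \<notin> T \<and> spread_le Q f s"] by blast
  obtain f where f: "f \<in> Q" "f \<notin> T" "spread_le Q f s" using s by blast
  obtain n where n: "comp f n \<notin> Q" "\<And>i. comp f i \<notin> Q \<Longrightarrow> i \<le> n \<and> n \<le> i + s"
    using spread_le_top[OF iQ f(3)] f(2) unfolding T_def by blast
  have fn_W: "comp f n \<in> W" using n(1) comp_mem[of f n] TQ by (auto simp: W_def)
  \<comment> \<open>With s = 0, f would agree modulo T with its component of degree n, which would
    then lie in Q. Positivity of s makes the induction parameter drop in the division.\<close>
  have "s \<noteq> 0"
  proof
    assume "s = 0"
    have "comp (f - comp f n) i \<in> Q" for i
    proof (cases "i = n")
      case False
      then have "comp f i \<in> Q" using n(2)[of i] \<open>s = 0\<close> by (metis add_0_right le_antisym)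
      then show ?thesis using False by (simp add: comp_diff comp_homogeneous[OF comp_mem])
    qed (simp add: comp_diff comp_homogeneous[OF comp_mem] ideal_zero[OF iQ])
    then have "f - comp f n \<in> Q" using star_subset[OF iQ] by (auto simp: star_def)
    then have "f - (f - comp f n) \<in> Q" using f(1) ideal_diff[OF iQ] by blast
    then show False using n(1) by simp
  qed
  have division: "\<exists>h\<in>W. \<exists>q. h * g - q * f \<in> T" if "g \<in> Q" "spread_le Q g s'" for g s'
    using that
  proof (induction s' arbitrary: g rule: less_induct)
    case (less s' g)
    show ?case
    proof (cases "g \<in> T")
      case True
      then show ?thesis using W.one_mem by (intro bexI[of _ 1] exI[of _ 0]) auto
    next
      case False
      then have "s \<le> s'" using min[of s'] less.prems by (meson not_le)
      obtain m where m: "comp g m \<notin> Q" "\<And>i. comp g i \<notin> Q \<Longrightarrow> i \<le> m \<and> m \<le> i + s'"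
        using spread_le_top[OF iQ less.prems(2)] False unfolding T_def by blast
      \<comment> \<open>Cross-multiplication by the leading coefficients cancels the components of
        degree n + m. The remaining components outside Q lie in degrees n + m - s' to n + m - 1; for
        the multiple of f this uses s <= s'.\<close>
      define g' where "g' = comp f n * g - comp g m * f"
      have "g' \<in> Q" unfolding g'_def using less.prems(1) f(1) iQ by (simp add: ideal_diff ideal_mult_left)
      have comp_g': "comp g' i = (if n \<le> i then comp f n * comp g (i - n) else 0) -
          (if m \<le> i then comp g m * comp f (i - m) else 0)" for i
        unfolding g'_def comp_diff by (simp add: comp_mult_homogeneous[OF comp_mem])
      have "i \<le> n + m - 1 \<and> n + m - 1 \<le> i + (s' - 1)" if i: "comp g' i \<notin> Q" for i
      proof -
        have "i \<noteq> n + m" using i ideal_zero[OF iQ] by (auto simp: comp_g' mult.commute)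
        have "(n \<le> i \<and> comp g (i - n) \<notin> Q) \<or> (m \<le> i \<and> comp f (i - m) \<notin> Q)"
        proof (rule ccontr)
          assume "\<not> ?thesis"
          then have "(if n \<le> i then comp f n * comp g (i - n) else 0) \<in> Q"
            "(if m \<le> i then comp g m * comp f (i - m) else 0) \<in> Q"
            by (simp_all add: ideal_mult_left[OF iQ] ideal_zero[OF iQ])
          then have "comp g' i \<in> Q" unfolding comp_g' by (rule ideal_diff[OF iQ])
          then show False using i by simp
        qed
        then have "i \<le> n + m \<and> n + m \<le> i + s'"
          using m(2)[of "i - n"] n(2)[of "i - m"] \<open>s \<le> s'\<close> by auto
        then show ?thesis using \<open>i \<noteq> n + m\<close> \<open>s \<noteq> 0\<close> \<open>s \<le> s'\<close> by linarith
      qed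
      then have "spread_le Q g' (s' - 1)" unfolding spread_le_def by blast
      then obtain h q where h: "h \<in> W" "h * g' - q * f \<in> T"
        using less.IH[of "s' - 1" g'] \<open>g' \<in> Q\<close> \<open>s \<noteq> 0\<close> \<open>s \<le> s'\<close> by auto
      have "(h * comp f n) * g - (h * comp g m + q) * f \<in> T"
        using h(2) by (simp add: g'_def algebra_simps)
      then show ?thesis using W.mult_mem[OF h(1) fn_W] by blast
    qed
  qed
  show "P = Q"
  proof (cases "f \<in> P")
    case True
    have "g \<in> P" if g: "g \<in> Q" for g
    proof -
      obtain h q where h: "h \<in> W" "h * g - q * f \<in> T" using division[OF g] ex_spread_le[OF iQ] by blast
      have "(h * g - q * f) + q * f \<in> P" using h(2) TP True iP by (intro ideal_add ideal_mult_left) auto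
      then show ?thesis using prime_ideal_mult[OF P, of h g] W_P[OF h(1)] by simp
    qed
    then show ?thesis using assms(4) by blast
  next
    case False
    have "\<exists>y\<in>P - T. \<exists>w\<in>W. \<exists>r. (w - r * f) * y \<in> T"
    proof (rule W.nakayama[OF noeth iT])
      show "P - T \<noteq> {}" using TP assms(6) star by (auto simp: T_def)
    next
      fix y assume y: "y \<in> P - T"
      obtain w q where w: "w \<in> W" "w * y - q * f \<in> T"
        using division y assms(4) ex_spread_le[OF iQ] by blast
      have "w * y \<in> P" "w * y - q * f \<in> P" using y w(2) TP ideal_mult_left[OF iP] by auto
      then have "w * y - (w * y - q * f) \<in> P" by (rule ideal_diff[OF iP])
      then have "q \<in> P" using prime_ideal_mult[OF P, of q f] False by simp
      moreover have "q \<notin> T"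
      proof
        assume "q \<in> T"
        then have "(w * y - q * f) + q * f \<in> T" using w(2) iT by (intro ideal_add ideal_mult_right)
        then show False using prime_ideal_mult[OF T, of w y] y w(1) by (auto simp: W_def)
      qed
      ultimately show "\<exists>w\<in>W. \<exists>y'\<in>P - T. w * y - f * y' \<in> T" using w by (auto simp: mult.commute[of q])
    qed
    then obtain y w r where y: "y \<in> P" "y \<notin> T" "w \<in> W" "(w - r * f) * y \<in> T" by blast
    \<comment> \<open>As y is outside the prime T, the factor \<open>w - r * f\<close> lies in T,
      hence in Q. Since f is in Q, so is w, although W does not meet Q.\<close>
    then have "w - r * f \<in> Q" using prime_ideal_mult[OF T] TQ by blast
    then have "(w - r * f) + r * f \<in> Q" using f(1) iQ by (intro ideal_add ideal_mult_left)
    then show ?thesis using W_Q[OF y(3)] by simp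
  qed
qed

end

section \<open>Standard graded rings over a local ring\<close>

definition prime_chain :: "nat \<Rightarrow> (nat \<Rightarrow> 'a::comm_ring_1 set) \<Rightarrow> bool" where
  "prime_chain n P \<longleftrightarrow> (\<forall>i\<le>n. prime_ideal (P i)) \<and> (\<forall>i<n. P i \<subset> P (Suc i))"

lemma prime_chain_snoc:
  assumes "prime_chain n P" and "prime_ideal Q" and "P n \<subset> Q"
  shows "prime_chain (Suc n) (P(Suc n := Q))"
  using assms by (auto simp: prime_chain_def le_Suc_eq less_Suc_eq)

locale graded_local_ring = graded_ring R
  for R :: "nat \<Rightarrow> 'a::comm_ring_1 set" +
  fixes m0 :: "'a set"
  assumes local: "local_ring_of (R 0) m0"
begin

text \<open>The homogeneous maximal ideal \<open>m\<^sub>0 \<oplus> R\<^sub>+\<close>.\<close>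

abbreviation \<mm> :: "'a set" where
  "\<mm> \<equiv> {x. comp x 0 \<in> m0}"

lemma m0_ideal: "ideal_of (R 0) m0" and m0_one: "1 \<notin> m0"
  using local by (auto simp: local_ring_of_def maximal_of_def)

lemma m0_subset: "m0 \<subseteq> R 0"
  using m0_ideal by (simp add: ideal_of_def)

lemma mult_zero_mem: "a \<in> R 0 \<Longrightarrow> b \<in> R 0 \<Longrightarrow> a * b \<in> R 0"
  using mult[of a 0 b 0] by simp

lemma unit_outside_m0:
  assumes "a \<in> R 0" and "a \<notin> m0"
  obtains b where "b \<in> R 0" "b * a = 1"
proof -
  let ?J = "{b * a | b. b \<in> R 0}"
  have "ideal_of (R 0) ?J"
    unfolding ideal_of_def
  proof (intro conjI ballI)
    show "?J \<subseteq> R 0" using assms(1) mult_zero_mem by auto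
    show "0 \<in> ?J" using zero_mem[of 0] by force
    show "x + y \<in> ?J" if "x \<in> ?J" "y \<in> ?J" for x y
      using that add_mem by (auto simp: distrib_right[symmetric])
    show "- x \<in> ?J" if x: "x \<in> ?J" for x
    proof -
      obtain b where "b \<in> R 0" "x = b * a" using x by blast
      then have "- b \<in> R 0" "- x = (- b) * a" using uminus_mem by simp_all
      then show ?thesis by blast
    qed
    show "r * x \<in> ?J" if "r \<in> R 0" "x \<in> ?J" for r x
      using that mult_zero_mem by (auto simp: mult.assoc[symmetric])
  qed
  moreover have "a \<in> ?J" using one by force
  ultimately have "1 \<in> ?J" using proper_ideal_subset_local[OF local] assms(2) by blast
  then show thesis using that by auto
qed

lemma prime_contraction:
  assumes "prime_ideal Q"
  shows "prime_of (R 0) (Q \<inter> R 0)"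
  using assms zero_mem add_mem uminus_mem mult_zero_mem
  by (auto simp: prime_of_def ideal_of_def)

lemma prime_contraction_subset: "prime_ideal Q \<Longrightarrow> Q \<inter> R 0 \<subseteq> m0"
  using prime_contraction[of Q] proper_ideal_subset_local[OF local] by (auto simp: prime_of_def)

lemma mm_prime: "prime_ideal \<mm>"
proof -
  have "ideal \<mm>"
    using m0_ideal comp_mem[of _ 0] by (simp add: ideal_of_def comp_add comp_uminus comp_mult_zero)
  moreover have "b \<in> m0" if "a \<in> R 0" "b \<in> R 0" "a * b \<in> m0" "a \<notin> m0" for a b
  proof -
    obtain c where "c \<in> R 0" "c * a = 1" using unit_outside_m0 \<open>a \<in> R 0\<close> \<open>a \<notin> m0\<close> .
    then have "c * (a * b) \<in> m0" using that(3) m0_ideal by (simp add: ideal_of_def)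
    then show ?thesis using \<open>c * a = 1\<close> by (simp add: mult.assoc[symmetric])
  qed
  ultimately show ?thesis
    using comp_mem[of _ 0] m0_one by (auto simp: prime_of_def comp_mult_zero comp_homogeneous[OF one])
qed

lemma star_prime_subset_mm: "prime_ideal Q \<Longrightarrow> star Q \<subseteq> \<mm>"
  using prime_contraction_subset[of Q] comp_mem[of _ 0] by (auto simp: star_def)

lemma mm_maximal:
  assumes Q: "prime_ideal Q" and "\<mm> \<subseteq> Q"
  shows "Q = \<mm>"
proof (intro equalityI assms(2) subsetI)
  fix x assume "x \<in> Q"
  have "x - comp x 0 \<in> Q"
    using assms(2) m0_ideal by (auto simp: comp_diff comp_homogeneous[OF comp_mem] ideal_of_def)
  then have "x - (x - comp x 0) \<in> Q" using \<open>x \<in> Q\<close> ideal_diff[OF prime_ideal_ideal[OF Q]] by blast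
  then show "x \<in> \<mm>" using prime_contraction_subset[OF Q] comp_mem[of x 0] by auto
qed

text \<open>Multipliers outside \<open>\<mm>\<close> have a unit as degree-zero component, so
  \<open>w * y\<close> in K determines the components of y modulo K from the lowest degree
  upwards.\<close>

lemma sat_homogeneous:
  assumes K: "ideal K" "star K = K"
  shows "sat (- \<mm>) K = K"
proof
  interpret mult_set "- \<mm>"
    using prime_ideal_one[OF mm_prime] prime_ideal_mult[OF mm_prime] by unfold_locales auto
  show "K \<subseteq> sat (- \<mm>) K" by (rule sat_superset)
  show "sat (- \<mm>) K \<subseteq> K"
  proof
    fix y assume "y \<in> sat (- \<mm>) K"
    then obtain w where w: "comp w 0 \<notin> m0" "w * y \<in> K" by (auto simp: sat_def)
    obtain v where v: "v * comp w 0 = 1" using unit_outside_m0[OF comp_mem w(1)] by blast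
    have "comp y n \<in> K" for n
    proof (induction n rule: less_induct)
      case (less n)
      have "comp (w * y) n = comp w 0 * comp y n + (\<Sum>i\<in>{..n} - {0}. comp w i * comp y (n - i))"
        unfolding comp_mult
      using sum.remove[of "{..n}" 0 "\<lambda>i. comp w i * comp y (n - i)"] by simp
      moreover have "(\<Sum>i\<in>{..n} - {0}. comp w i * comp y (n - i)) \<in> K"
        using less by (intro ideal_sum K(1)) (auto intro!: ideal_mult_left[OF K(1)])
      moreover have "comp (w * y) n \<in> K" using w(2) K(2) by (auto simp: star_def)
      ultimately have "comp w 0 * comp y n \<in> K" using ideal_diff[OF K(1)] by (metis add_diff_cancel_right')
      then have "v * (comp w 0 * comp y n) \<in> K" by (rule ideal_mult_left[OF K(1)])
      then show ?case using v by (simp add: mult.assoc[symmetric])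
    qed
    then have "y \<in> star K" by (simp add: star_def)
    then show "y \<in> K" using K(2) by simp
  qed
qed

text \<open>If the last two primes have different stars, the induction hypothesis for the shorter
  chain is extended by the last star. If the stars agree, \<open>no_prime_between_star\<close> makes
  the last prime but one equal to that star, and the chain is simply cut there.\<close>

lemma prime_chain_star:
  assumes noeth: "noetherian_of (UNIV :: 'a set)"
  shows "prime_chain (Suc n) P \<Longrightarrow> \<exists>P'. prime_chain n P' \<and> P' n = star (P (Suc n))"
proof (induction n arbitrary: P)
  case 0
  then show ?case by (intro exI[of _ "\<lambda>_. star (P 1)"]) (simp add: prime_chain_def star_prime)
next
  case (Suc n)
  let ?P = "P (Suc n)" and ?Q = "P (Suc (Suc n))"
  have PQ: "prime_ideal ?P" "prime_ideal ?Q" "?P \<subset> ?Q" "prime_chain (Suc n) P"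
    using Suc.prems by (auto simp: prime_chain_def)
  show ?case
  proof (cases "star ?P = star ?Q")
    case True
    then have "star ?P = ?P" using no_prime_between_star[OF noeth PQ(1,2)] PQ(3) by auto
    then show ?thesis using True PQ(4) by (intro exI[of _ P]) simp
  next
    case False
    then have sub: "star ?P \<subset> star ?Q" using star_mono PQ(3) by blast
    obtain P' where "prime_chain n P'" "P' n = star ?P" using Suc.IH[OF PQ(4)] by blast
    then have "prime_chain (Suc n) (P'(Suc n := star ?Q))"
      using prime_chain_snoc[of n P' "star ?Q"] star_prime[OF PQ(2)] sub by metis
    moreover have "(P'(Suc n := star ?Q)) (Suc n) = star ?Q" by simp
    ultimately show ?thesis by blast
  qed
qed

text \<open>This makes the dimension of R the height of \<open>\<mm>\<close>. When the last prime is
  inhomogeneous, its star is strictly below \<open>\<mm>\<close> because \<open>\<mm>\<close> is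
  maximal, so the step lost in \<open>prime_chain_star\<close> is recovered by appending
  \<open>\<mm>\<close>.\<close>

lemma prime_chain_below_mm:
  assumes noeth: "noetherian_of (UNIV :: 'a set)" and P: "prime_chain n (P :: nat \<Rightarrow> 'a set)"
  shows "\<exists>P'. prime_chain n P' \<and> P' n \<subseteq> \<mm>"
proof -
  have Pn: "prime_ideal (P n)" using P by (simp add: prime_chain_def)
  show ?thesis
  proof (cases "star (P n) = P n")
    case True
    then show ?thesis using P star_prime_subset_mm[OF Pn] by auto
  next
    case False
    show ?thesis
    proof (cases n)
      case 0
      then show ?thesis using star_prime[OF Pn] star_prime_subset_mm[OF Pn]
        by (intro exI[of _ "\<lambda>_. star (P n)"]) (simp add: prime_chain_def)
    next
      case (Suc k)
      obtain P' where P': "prime_chain k P'" "P' k = star (P n)"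
        using prime_chain_star[OF noeth] P Suc by blast
      have "star (P n) \<noteq> \<mm>"
      proof
        assume eq: "star (P n) = \<mm>"
        then have "P n = \<mm>" using mm_maximal[OF Pn] star_subset[OF prime_ideal_ideal[OF Pn]] by simp
        then show False using False eq by simp
      qed
      then have "P' k \<subset> \<mm>" using P'(2) star_prime_subset_mm[OF Pn] by blast
      then have "prime_chain n (P'(n := \<mm>))" using prime_chain_snoc[OF P'(1) mm_prime] Suc by simp
      moreover have "(P'(n := \<mm>)) n \<subseteq> \<mm>" by simp
      ultimately show ?thesis by blast
    qed
  qed
qed

end

section \<open>Dimension and height as suprema over chains of primes\<close>

lemma prime_chain_subset: "prime_chain n P \<Longrightarrow> i \<le> n \<Longrightarrow> P 0 \<subseteq> P i"
proof (induction i)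
  case (Suc i)
  then have "P i \<subset> P (Suc i)" by (simp add: prime_chain_def)
  then show ?case using Suc by auto
qed simp

lemma prime_chain_le_dim:
  assumes P: "prime_chain n P" and "I \<subseteq> P 0"
  shows "enat n \<le> dim_above UNIV I"
  unfolding dim_above_def
proof (intro Sup_upper CollectI exI conjI refl)
  show "\<forall>i\<le>n. prime_ideal (P i) \<and> I \<subseteq> P i"
    using prime_chain_subset[OF P] assms by (auto simp: prime_chain_def)
  show "\<forall>i<n. P i \<subset> P (Suc i)" using P by (simp add: prime_chain_def)
qed simp

lemma prime_chain_le_height:
  assumes P: "prime_chain n P" and "P n \<subseteq> Q"
  shows "enat n \<le> height_of UNIV Q"
  unfolding height_of_def
proof (intro Sup_upper CollectI exI conjI refl)
  show "\<forall>i\<le>n. prime_ideal (P i)" "\<forall>i<n. P i \<subset> P (Suc i)" "P n \<subseteq> Q"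
    using assms by (auto simp: prime_chain_def)
qed simp

text \<open>A natural number below the supremum is reached by a member even if the supremum is
  infinite. The witness \<open>x0\<close> covers n = 0, since the supremum of the empty set is
  0.\<close>

lemma Sup_enat_attained:
  assumes "enat n \<le> Sup {enat (f x) | x. Q x}" and "Q x0"
  obtains x where "Q x" "n \<le> f x"
proof (cases n)
  case 0
  then show thesis using that assms(2) by blast
next
  case (Suc k)
  then have "enat k < Sup {enat (f x) | x. Q x}" using assms(1) by (simp add: Suc_ile_eq)
  then obtain x where "Q x" "enat k < enat (f x)" unfolding less_Sup_iff by blast
  then show thesis using that Suc by simp
qed

lemma (in graded_ring) power_mem: "x \<in> R n \<Longrightarrow> x ^ k \<in> R (n * k)"
  using one by (induction k) (simp_all add: mult)

lemma (in graded_ring) ann_homogeneous: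
  assumes M: "graded_module R sm Mg"
  shows "ideal (ann_of UNIV sm UNIV)" and "star (ann_of UNIV sm UNIV) = ann_of UNIV sm UNIV"
proof -
  interpret module sm using M by (simp add: graded_module_def)
  interpret M: graded_group Mg using M by unfold_locales (simp add: graded_module_def)
  have smult: "sm a x \<in> Mg (i + j)" if "a \<in> R i" "x \<in> Mg j" for a x i j
    using M that by (simp add: graded_module_def)
  show ann: "ideal (ann_of UNIV sm UNIV)"
    by (auto simp: ideal_of_def ann_of_def scale_left_distrib scale_scale[symmetric] simp del: scale_scale)
  show "star (ann_of UNIV sm UNIV) = ann_of UNIV sm UNIV"
  proof (intro equalityI star_subset[OF ann] subsetI)
    fix r assume "r \<in> ann_of UNIV sm UNIV"
    then have r: "sm r x = 0" for x by (simp add: ann_of_def)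
    obtain N where N: "\<And>n. n > N \<Longrightarrow> comp r n = 0" "r = (\<Sum>n\<le>N. comp r n)"
      using bounded_decomp[of r] by blast
    \<comment> \<open>For x homogeneous of degree j the products \<open>sm (comp r i) x\<close> lie
      in the distinct degrees i + j, so they vanish separately.\<close>
    have hom: "sm (comp r n) x = 0" if x: "x \<in> Mg j" for n x j
    proof (cases "n \<le> N")
      case True
      have "0 = M.comp (sm r x) (n + j)" by (simp add: r)
      also have "\<dots> = M.comp (\<Sum>i\<le>N. sm (comp r i) x) (n + j)"
        by (subst N(2)) (simp add: scale_sum_left)
      also have "\<dots> = (\<Sum>i\<le>N. if i = n then sm (comp r n) x else 0)"
        unfolding M.comp_sum
        by (intro sum.cong refl) (simp add: M.comp_homogeneous[OF smult[OF comp_mem x]])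
      also have "\<dots> = sm (comp r n) x" using True by simp
      finally show ?thesis by simp
    next
      case False
      then show ?thesis using N(1)[of n] by simp
    qed
    have "sm (comp r n) x = 0" for n x
    proof -
      have "sm (comp r n) (\<Sum>j\<in>{j. M.comp x j \<noteq> 0}. M.comp x j) = 0"
        unfolding scale_sum_right by (intro sum.neutral ballI hom[OF M.comp_mem])
      then show ?thesis using M.sum_comp[OF M.finite_comp, of x x] by simp
    qed
    then show "r \<in> star (ann_of UNIV sm UNIV)" by (simp add: star_def ann_of_def)
  qed
qed

section \<open>Building the homogeneous regular sequence\<close>

context graded_local_ring
begin

lemma mem_irrelevant_iff: "x \<in> irrelevant R \<longleftrightarrow> comp x 0 = 0"
proof
  assume "x \<in> irrelevant R"
  then obtain c where c: "\<And>n. c n \<in> R n" "finite {n. c n \<noteq> 0}" "c 0 = 0" "x = (\<Sum>n\<in>{n. c n \<noteq> 0}. c n)"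
    unfolding irrelevant_def by blast
  have "comp x = c" using c by (intro comp_unique[of "{n. c n \<noteq> 0}"]) auto
  then show "comp x 0 = 0" using c(3) by simp
next
  assume "comp x 0 = 0"
  then show "x \<in> irrelevant R"
    unfolding irrelevant_def using comp_props[of x] by blast
qed

text \<open>R modulo its irrelevant ideal is \<open>R 0\<close>. The contractions stay distinct
  because an element of a prime above that ideal may be replaced by its degree-zero
  component.\<close>

lemma prime_chain_above_irrelevant:
  assumes P: "prime_chain n P" and sub: "irrelevant R \<subseteq> P 0"
  shows "enat n \<le> mdim (R 0) (*) (R 0)"
  unfolding mdim_def dim_above_def
proof (intro Sup_upper CollectI exI conjI refl)
  have ann: "ann_of (R 0) (*) (R 0) = {0}"
    using one zero_mem[of 0] by (auto simp: ann_of_def)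
  show "\<forall>i\<le>n. prime_of (R 0) (P i \<inter> R 0) \<and> ann_of (R 0) (*) (R 0) \<subseteq> P i \<inter> R 0"
    using P prime_contraction zero_mem[of 0] unfolding ann
    by (auto simp: prime_chain_def intro: ideal_zero prime_ideal_ideal)
  show "\<forall>i<n. P i \<inter> R 0 \<subset> P (Suc i) \<inter> R 0"
  proof (intro allI impI)
    fix i assume i: "i < n"
    then have lt: "P i \<subset> P (Suc i)" and id: "ideal (P i)" "ideal (P (Suc i))"
      using P by (auto simp: prime_chain_def intro: prime_ideal_ideal)
    obtain x where x: "x \<in> P (Suc i)" "x \<notin> P i" using lt by blast
    have "x - comp x 0 \<in> irrelevant R"
      by (simp add: mem_irrelevant_iff comp_diff comp_homogeneous[OF comp_mem])
    then have pos: "x - comp x 0 \<in> P i"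
      using prime_chain_subset[OF P, of i] i sub by auto
    then have "x - comp x 0 \<in> P (Suc i)" using lt by blast
    with x(1) have "x - (x - comp x 0) \<in> P (Suc i)" by (rule ideal_diff[OF id(2)])
    moreover have "comp x 0 \<notin> P i"
      using ideal_add[OF id(1) pos, of "comp x 0"] x(2) by auto
    ultimately show "P i \<inter> R 0 \<subset> P (Suc i) \<inter> R 0" using lt comp_mem[of x 0] by auto
  qed
qed simp

lemma homogeneous_regular_sequence:
  assumes noeth: "noetherian_of (UNIV :: 'a set)"
    and xs: "regular {0} xs" "set xs \<subseteq> \<mm>"
    and I: "ideal I" "star I = I"
    and dim: "\<And>n P. prime_chain n P \<Longrightarrow> I \<subseteq> P 0 \<or> irrelevant R \<subseteq> P 0 \<Longrightarrow> n \<le> e"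
  shows "g \<le> length xs - e \<Longrightarrow>
    \<exists>\<xi>s. length \<xi>s = g \<and> set \<xi>s \<subseteq> {x \<in> I. \<exists>n\<ge>1. x \<in> R n} \<and> regular {0} \<xi>s"
proof (induction g)
  case 0
  then show ?case by simp
next
  case (Suc g)
  define H where "H = {x \<in> I. \<exists>n\<ge>1. x \<in> R n}"
  obtain \<xi>s where \<xi>s: "length \<xi>s = g" "set \<xi>s \<subseteq> H" "regular {0} \<xi>s"
    using Suc unfolding H_def by auto
  interpret noetherian_at_prime \<mm>
    using noeth mm_prime by unfold_locales
  have H_mm: "H \<subseteq> \<mm>"
    using m0_ideal by (auto simp: H_def comp_homogeneous ideal_of_def)
  define K where "K = adjs {0} \<xi>s"
  have K: "ideal K" "star K = K" unfolding K_def
  proof -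
    show "ideal (adjs {0} \<xi>s)" by (intro adjs_ideal ideal_singleton_zero)
    have "star {0} = {0}" using star_subset[OF ideal_singleton_zero] by (auto simp: star_def)
    then show "star (adjs {0} \<xi>s) = adjs {0} \<xi>s"
      using \<xi>s(2) by (intro homogeneous_adjs ideal_singleton_zero) (auto simp: H_def)
  qed
  have "set \<xi>s \<subseteq> \<mm>" "length \<xi>s \<le> length xs" using \<xi>s(1,2) H_mm Suc.prems by auto
  \<comment> \<open>By Rees' theorem at least e + 1 further entries fit in \<open>\<mm>\<close>, as
    g + 1 <= \<open>length xs - e\<close>. They need not lie in I and serve only to produce a long
    chain of primes.\<close>
  then obtain zs where zs: "regular K zs" "set zs \<subseteq> \<mm>" "g + length zs = length xs"
    using regular_extend[OF noeth prime_ideal_ideal[OF mm_prime] ideal_singleton_zero xs \<xi>s(3)]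
    unfolding K_def \<xi>s(1) by metis
  have "\<exists>z\<in>H. z \<notin> \<Union>(maximal_colons K)"
  proof (rule prime_avoidance)
    show "x * y \<in> H" if xy: "x \<in> H" "y \<in> H" for x y
    proof -
      obtain i j where "1 \<le> i" "x \<in> R i" "y \<in> R j" "x \<in> I" using xy by (auto simp: H_def)
      then have "1 \<le> i + j" "x * y \<in> R (i + j)" "x * y \<in> I" using mult ideal_mult_right[OF I(1)] by auto
      then show ?thesis unfolding H_def by blast
    qed
    show "\<exists>i j. 0 < i \<and> 0 < j \<and> x ^ i + y ^ j \<in> H" if "x \<in> H" "y \<in> H" for x y
    proof -
      obtain i j where ij: "1 \<le> i" "1 \<le> j" "x \<in> R i" "y \<in> R j" "x \<in> I" "y \<in> I"
        using \<open>x \<in> H\<close> \<open>y \<in> H\<close> by (auto simp: H_def)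
      have pow: "a ^ k \<in> I" if "a \<in> I" "1 \<le> k" for a k
        using that ideal_mult_right[OF I(1), of a "a ^ (k - 1)"] by (cases k) simp_all
      have "x ^ j + y ^ i \<in> I" using ij by (intro ideal_add I pow)
      moreover have "x ^ j + y ^ i \<in> R (i * j)"
        using add_mem[OF power_mem[OF ij(3), of j]] power_mem[OF ij(4), of i] by (simp add: mult.commute)
      moreover have "1 \<le> i * j" using ij(1,2) by simp
      ultimately have "x ^ j + y ^ i \<in> H" unfolding H_def by blast
      \<comment> \<open>The exponents are crossed: x of degree i is raised to j and y of degree j to
        i, so both powers have degree i * j.\<close>
      then show ?thesis using ij(1,2) by (intro exI[of _ j] exI[of _ i]) simp
    qed
    show "H \<noteq> {}" using ideal_zero[OF I(1)] zero_mem[of 1] by (auto simp: H_def)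
    show "finite (maximal_colons K)" by (rule finite_maximal_colons[OF noeth K(1)])
    show prime: "prime_ideal P" if "P \<in> maximal_colons K" for P
      using maximal_colons_prime[OF K(1) that] .
    show "\<not> H \<subseteq> P" if P: "P \<in> maximal_colons K" for P
    proof
      assume HP: "H \<subseteq> P"
      note iP = prime_ideal_ideal[OF prime[OF P]]
      \<comment> \<open>H contains only homogeneous elements. Suitable components of a in I and b in
        the irrelevant ideal, both outside P, have a product in H; its degree is positive thanks to
        the factor from b.\<close>
      have "I \<subseteq> P \<or> irrelevant R \<subseteq> P"
      proof (rule ccontr)
        assume "\<not> ?thesis"
        then obtain a b where a: "a \<in> I" "a \<notin> P" and b: "comp b 0 = 0" "b \<notin> P"
          unfolding subset_iff mem_irrelevant_iff by blast
        obtain i where i: "comp a i \<notin> P" using a(2) star_subset[OF iP] by (auto simp: star_def)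
        obtain j where j: "comp b j \<notin> P" using b(2) star_subset[OF iP] by (auto simp: star_def)
        have "comp a i * comp b j \<in> I"
          using a(1) I(2) by (intro ideal_mult_right[OF I(1)]) (auto simp: star_def)
        moreover have "comp a i * comp b j \<in> R (i + j)" by (intro mult comp_mem)
        moreover have "1 \<le> i + j" using j b(1) ideal_zero[OF iP] by (cases j) auto
        ultimately have "comp a i * comp b j \<in> P" using HP unfolding H_def by blast
        then show False using prime_ideal_mult[OF prime[OF P]] i j by blast
      qed
      moreover obtain u where u: "u \<notin> K" "P = colon K u" using P by (auto simp: maximal_colons_def)
      then have "\<exists>Q. Q 0 = P \<and> (\<forall>i\<le>length zs. prime_ideal (Q i)) \<and> (\<forall>i<length zs. Q i \<subset> Q (Suc i))"
        using chain_above_associated[OF K(1) zs(1,2) prime[OF P]] sat_homogeneous[OF K] by metis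
      then obtain Q where "Q 0 = P" "prime_chain (length zs) Q" unfolding prime_chain_def by blast
      ultimately have "length zs \<le> e" using dim by blast
      then show False using zs(3) Suc.prems by linarith
    qed
  qed
  then obtain z where "z \<in> H" "nzd K z" using nzd_iff_maximal_colons[OF noeth K(1)] by blast
  then have "length (\<xi>s @ [z]) = Suc g \<and> set (\<xi>s @ [z]) \<subseteq> H \<and> regular {0} (\<xi>s @ [z])"
    using \<xi>s by (simp add: regular_append K_def)
  then show ?case unfolding H_def by blast
qed

text \<open>A chain of length d is moved below \<open>\<mm>\<close>, so d is at most the height of
  \<open>\<mm>\<close>, which is its grade by the Cohen-Macaulay property. A regular sequence in
  \<open>\<mm>\<close> of length at least d is then truncated.\<close>

lemma regular_sequence_of_dim:
  assumes CM: "CM_ring (UNIV :: 'a set)" and dim: "enat d \<le> mdim UNIV (*) (UNIV :: 'a set)"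
  obtains xs where "regular {0} xs" "set xs \<subseteq> \<mm>" "length xs = d"
proof -
  have noeth: "noetherian_of (UNIV :: 'a set)" using CM by (simp add: CM_ring_def)
  have "ann_of UNIV (*) (UNIV :: 'a set) = {0}" by (auto simp: ann_of_def dest: spec[of _ 1])
  then have "enat d \<le> Sup {enat n | n. \<exists>P. (\<forall>i\<le>n. prime_ideal (P i) \<and> {0 :: 'a} \<subseteq> P i) \<and>
      (\<forall>i<n. P i \<subset> P (Suc i))}"
    using dim by (simp add: mdim_def dim_above_def)
  then obtain n where n: "\<exists>P. (\<forall>i\<le>n. prime_ideal (P i) \<and> {0 :: 'a} \<subseteq> P i) \<and> (\<forall>i<n. P i \<subset> P (Suc i))"
      and "d \<le> n"
  proof (rule Sup_enat_attained[where f = "\<lambda>n. n"])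
    show "\<exists>P. (\<forall>i\<le>0. prime_ideal (P i) \<and> {0 :: 'a} \<subseteq> P i) \<and> (\<forall>i<0. P i \<subset> P (Suc i))"
      using mm_prime ideal_zero[OF prime_ideal_ideal[OF mm_prime]] by (intro exI[of _ "\<lambda>_. \<mm>"]) simp
  qed blast
  then obtain P :: "nat \<Rightarrow> 'a set" where "prime_chain d P"
    unfolding prime_chain_def by (meson le_trans less_le_trans)
  then obtain P' where "prime_chain d P'" "P' d \<subseteq> \<mm>" using prime_chain_below_mm[OF noeth] by blast
  then have "enat d \<le> grade_of UNIV (*) \<mm> UNIV"
    using prime_chain_le_height CM mm_prime by (simp add: CM_ring_def)
  then have "enat d \<le> Sup {enat (length xs) | xs. set xs \<subseteq> \<mm> \<and> reg_seq UNIV (*) UNIV xs}"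
    by (simp add: grade_of_def)
  then obtain xs where xs: "set xs \<subseteq> \<mm> \<and> reg_seq UNIV (*) UNIV xs" "d \<le> length xs"
  proof (rule Sup_enat_attained)
    show "set [] \<subseteq> \<mm> \<and> reg_seq UNIV (*) UNIV []"
      using zero_neq_one by (auto simp: reg_seq_iff_regular dest: arg_cong[of _ _ "\<lambda>A. 1 \<in> A"])
  qed blast
  then have "regular {0} (take d xs)"
    using regular_append[of "{0}" "take d xs" "drop d xs"] by (simp add: reg_seq_iff_regular)
  then show thesis using that[of "take d xs"] xs set_take_subset[of d xs] by auto
qed

end

theorem theorem5p2:
  fixes Rg :: "nat \<Rightarrow> 'a::comm_ring_1 set"
    and m0 :: "'a set"
    and sm :: "'a \<Rightarrow> 'm::ab_group_add \<Rightarrow> 'm"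
    and Mg :: "nat \<Rightarrow> 'm set"
    and ys :: "'a list"
  assumes R0_noeth: "noetherian_of (Rg 0)"
    and R0_local: "local_ring_of (Rg 0) m0"
    and R_std: "standard_graded Rg"
    and R_hsop: "\<exists>xs. (\<forall>x\<in>set xs. homogeneous Rg x) \<and> sop UNIV (*) (hom_max Rg m0) UNIV xs"
    and M_graded: "graded_module Rg sm Mg"
    and M_fg: "\<exists>F. finite F \<and> module.span sm F = UNIV"
    and R0_CM: "CM_ring (Rg 0)"
    and R_CM: "CM_ring (UNIV :: 'a set)"
    and M_gen0: "module.span sm (Mg 0) = UNIV"
    and ys_R0: "set ys \<subseteq> Rg 0"
    and ys_sop_M0: "sop (Rg 0) sm m0 (Mg 0) ys"
    and ys_sop_R0: "sop (Rg 0) (*) m0 (Rg 0) ys"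
    and ys_part_M: "\<exists>zs. (\<forall>z\<in>set zs. homogeneous Rg z) \<and> sop UNIV sm (hom_max Rg m0) UNIV (ys @ zs)"
    and ys_part_R: "\<exists>zs. (\<forall>z\<in>set zs. homogeneous Rg z) \<and> sop UNIV (*) (hom_max Rg m0) UNIV (ys @ zs)"
  shows "\<exists>\<xi>s :: 'a list.
           enat (length \<xi>s) = mdim UNIV (*) (UNIV :: 'a set) - mdim UNIV sm (UNIV :: 'm set) \<and>
           (\<forall>\<xi>\<in>set \<xi>s. \<exists>n\<ge>1. \<xi> \<in> Rg n) \<and>
           (\<forall>\<xi>\<in>set \<xi>s. \<xi> \<in> ann_of UNIV sm UNIV) \<and>
           reg_seq UNIV (*) UNIV \<xi>s"
proof -
  interpret graded_local_ring Rg m0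
    using R_std R0_local by unfold_locales (auto simp: standard_graded_def)
  let ?I = "ann_of UNIV sm UNIV"
  note I = ann_homogeneous[OF M_graded]
  have noeth: "noetherian_of (UNIV :: 'a set)" using R_CM by (simp add: CM_ring_def)
  \<comment> \<open>The length of a system of parameters equals the dimension, which is therefore
    finite.\<close>
  obtain d where d: "mdim UNIV (*) (UNIV :: 'a set) = enat d"
    using R_hsop by (metis sop_def)
  obtain zs where "sop UNIV sm (hom_max Rg m0) UNIV (ys @ zs)" using ys_part_M by blast
  then have e: "mdim UNIV sm (UNIV :: 'm set) = enat (length ys + length zs)" by (simp add: sop_def)
  obtain xs where xs: "regular {0} xs" "set xs \<subseteq> \<mm>" "length xs = d"
    using regular_sequence_of_dim[OF R_CM, of d] d by auto
  \<comment> \<open>The bound e = \<open>length ys + length zs\<close> serves both cases: it is dim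
    M, and it is at least \<open>length ys\<close>, which is the dimension of
    \<open>Rg 0\<close>.\<close>
  have dim: "n \<le> length ys + length zs" if "prime_chain n P" "?I \<subseteq> P 0 \<or> irrelevant Rg \<subseteq> P 0" for n P
    using that(2)
  proof
    assume "?I \<subseteq> P 0"
    then have "enat n \<le> enat (length ys + length zs)"
      using prime_chain_le_dim[OF that(1)] e unfolding mdim_def by metis
    then show ?thesis by simp
  next
    assume "irrelevant Rg \<subseteq> P 0"
    then have "enat n \<le> enat (length ys)"
      using prime_chain_above_irrelevant[OF that(1)] ys_sop_R0 by (simp add: sop_def)
    then show ?thesis by simp
  qed
  have "\<exists>\<xi>s. length \<xi>s = d - (length ys + length zs) \<and> set \<xi>s \<subseteq> {x \<in> ?I. \<exists>n\<ge>1. x \<in> Rg n} \<and>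
      regular {0} \<xi>s"
    using homogeneous_regular_sequence[OF noeth xs(1,2) I dim] by (simp add: xs(3))
  then obtain \<xi>s where \<xi>s: "length \<xi>s = d - (length ys + length zs)"
      "set \<xi>s \<subseteq> {x \<in> ?I. \<exists>n\<ge>1. x \<in> Rg n}" "regular {0} \<xi>s"
    by blast
  \<comment> \<open>Positive degree places the sequence in \<open>\<mm>\<close>, so it generates a
    proper ideal. This is the condition that \<open>reg_seq\<close> adds to
    \<open>regular\<close>.\<close>
  have "set \<xi>s \<subseteq> \<mm>"
    using \<xi>s(2) m0_ideal by (auto simp: comp_homogeneous ideal_of_def subset_iff)
  then have "adjs {0} \<xi>s \<subseteq> \<mm>"
    using ideal_zero[OF prime_ideal_ideal[OF mm_prime]]
    by (intro adjs_least prime_ideal_ideal[OF mm_prime]) auto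
  then have "adjs {0} \<xi>s \<noteq> UNIV" using prime_ideal_one[OF mm_prime] by blast
  then have "reg_seq UNIV (*) UNIV \<xi>s" using \<xi>s(3) by (simp add: reg_seq_iff_regular)
  then show ?thesis
    using \<xi>s(1,2) unfolding d e by (intro exI[of _ \<xi>s]) (auto simp: subset_iff)
qed

end
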